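(* Consider the sequence $\{\omega_t^s\}_{0\le t\le m-1,\ s\ge 1}$ (ordered lexicographically in $(s,t)$) produced by Algorithm 1 (described in the context) run with $S=\infty$. Assume: (i) $f$ is thrice continuously differentiable and each $f_i$, $i=1,\dots,n$, is twice continuously differentiable; (ii) all iterates stay in a compact neighbourhood $\Omega$ of $\omega^*$; there is $\rho>0$ such that for every $\omega\in\Omega$, with $B(0_\omega,\rho)\subset T_\omega\mathcal M$ the ball of radius $\rho$ centred at $0_\omega$, $R_\omega$ is a diffeomorphism on $B(0_\omega,\rho)$ and $\Omega\subset R_\omega(B(0_\omega,\rho))$; and $R_{\omega_t^s}(-\tau\alpha_t^sV_t^s)\in\Omega$ for all $t\ge 0$, $s\ge 1$, $\tau\in[0,1]$; (iii) $\sum_{s=1}^{\infty}\sum_{t=0}^{m-1}\alpha_t^s=\infty$ and $\sum_{s=1}^{\infty}\sum_{t=0}^{m-1}(\alpha_t^s)^2<\infty$; (iv) the vector transport $\mathcal T$ is continuous and isometric on $\mathcal M$, i.e. $\langle\mathcal T_\eta\xi,\mathcal T_\eta\zeta\rangle=\langle\xi,\zeta\rangle$ for all $\omega\in\mathcal M$ and $\eta,\xi,\zeta\in T_\omega\mathcal M$. If $f\ge0$, then $\mathrm{grad}f(\omega_t^s)\to0$ almost surely (i.e. $\|\mathrm{grad}f(\omega_t^s)\|\to0$ along the sequence) and $\{f(\omega_t^s)\}$ converges almost surely to a finite random variable.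
   Context: $\mathcal M$ is a smooth Riemannian manifold with metric $\langle\cdot,\cdot\rangle$ and induced norm $\|\cdot\|$ on tangent spaces. $f_1,\dots,f_n:\mathcal M\to\mathbb R$ and $f=\frac1n\sum_{i=1}^n f_i$; $\mathrm{grad}$ is the Riemannian gradient; $\omega^*$ is a global minimizer of $f$. $R:T\mathcal M\to\mathcal M$ is a retraction: its restriction $R_\omega$ to $T_\omega\mathcal M$ satisfies $R_\omega(0_\omega)=\omega$ and $DR_\omega(0_\omega)[\xi]=\xi$. $\mathcal T$ is a vector transport: a smooth map $(\eta_\omega,\xi_\omega)\mapsto\mathcal T_{\eta_\omega}(\xi_\omega)\in T_{R_\omega(\eta_\omega)}\mathcal M$, linear in $\xi_\omega$, with $\mathcal T_{0_\omega}\xi=\xi$. One writes $\mathcal T_\omega^{R_\omega(\eta)}:=\mathcal T_\eta$ for $\eta \in T_\omega\mathcal M$. Algorithm 1 (R-SHG with adaptive parameters). Input: step sizes $\alpha_t^s>0$, an integer $m\ge1$, a constant $0<\mu<1$, parameters $\phi_t^s,\psi_t^s\ge0$ with $\phi_t^s+\psi_t^s\le1$, and an initial point $\tilde\omega^0$. For $s=1,2,\dots,S$: set $\omega_0^s=\tilde\omega^{s-1}$, $V_0^s=\mathrm{grad}f(\omega_0^s)$, $\omega_1^s=R_{\omega_0^s}(-\alpha_0^sV_0^s)$. For $t=1,\dots,m-1$: choose an index set $I_t^s\subset\{1,\dots,n\}$ of given cardinality $b$ uniformly at random (independently of the past) and write $\mathrm{grad}f_{I_t^s}=\frac1{|I_t^s|}\sum_{i\in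 I_t^s}\mathrm{grad}f_i$; let $D_t^s=\langle\mathcal T_{\omega_{t-1}^s}^{\omega_t^s}(V_{t-1}^s-\mathrm{grad}f(\omega_{t-1}^s)),\mathrm{grad}f(\omega_t^s)\rangle$; put $\tilde\psi_t^s=\min\{\psi_t^s,\ \mu\|\mathrm{grad}f(\omega_t^s)\|^2/|D_t^s|\}$ if $D_t^s\ne0$ and $\tilde\psi_t^s=\psi_t^s$ otherwise; set $$V_t^s=\phi_t^s\big(\mathrm{grad}f_{I_t^s}(\omega_t^s)-\mathcal T_{\omega_0^s}^{\omega_t^s}(\mathrm{grad}f_{I_t^s}(\omega_0^s)-\mathrm{grad}f(\omega_0^s))\big)+\tilde\psi_t^s\big(\mathrm{grad}f_{I_t^s}(\omega_t^s)-\mathcal T_{\omega_{t-1}^s}^{\omega_t^s}(\mathrm{grad}f_{I_t^s}(\omega_{t-1}^s)-V_{t-1}^s)\big)+(1-\phi_t^s-\tilde\psi_t^s)\mathrm{grad}f_{I_t^s}(\omega_t^s)$$ and $\omega_{t+1}^s=R_{\omega_t^s}(-\alpha_t^sV_t^s)$. Then $\tilde\omega^s=\omega_m^s$. *)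

theory Defs
  imports "HOL-Probability.Probability"
begin

section \<open>Differentiability classes\<close>

text \<open>Intended for open \<open>S\<close>. As the domain is finite-dimensional, this is the usual class
  \<open>C\<^sup>k\<close>: for every direction \<open>v\<close> the directional derivative is of class one lower.\<close>

primrec Ck_on :: "nat \<Rightarrow> ('e::euclidean_space \<Rightarrow> 'f::real_normed_vector) \<Rightarrow> 'e set \<Rightarrow> bool" where
  "Ck_on 0 f S \<longleftrightarrow> continuous_on S f"
| "Ck_on (Suc k) f S \<longleftrightarrow> (\<forall>x\<in>S. f differentiable (at x)) \<and>
     (\<forall>v. Ck_on k (\<lambda>x. frechet_derivative f (at x) v) S)"

section \<open>Smooth manifolds\<close>

type_synonym ('a, 'e) chart = "'a set \<times> ('a \<Rightarrow> 'e)"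

definition chart_inv :: "('a, 'e) chart \<Rightarrow> 'e \<Rightarrow> 'a" where
  "chart_inv c = inv_into (fst c) (snd c)"

text \<open>The manifold is the whole type \<open>'a\<close>; the model space is \<open>'e\<close>.\<close>

definition smooth_atlas ::
  "('a::{t2_space,second_countable_topology}, 'e::euclidean_space) chart set \<Rightarrow> bool" where
  "smooth_atlas A \<longleftrightarrow>
     (\<forall>c\<in>A. open (fst c) \<and> open (snd c ` fst c) \<and>
        homeomorphism (fst c) (snd c ` fst c) (snd c) (chart_inv c)) \<and>
     (\<Union>c\<in>A. fst c) = UNIV \<and>
     (\<forall>c\<in>A. \<forall>d\<in>A. \<forall>k. Ck_on k (snd d \<circ> chart_inv c) (snd c ` (fst c \<inter> fst d)))"

text \<open>Maps of class \<open>C\<^sup>k\<close> from the open subset \<open>W\<close> of a manifold with atlas \<open>A\<close> to a manifold with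
  atlas \<open>B\<close>. The topologies are those induced by the atlases, and nothing is assumed about a
  topology on the types: the openness clause, required for all pairs of charts, says that \<open>W\<close> is
  open and \<open>F\<close> is continuous on it. This matters for the tangent bundle below, whose topology is
  not the product topology of \<open>'a \<times> 'e\<close>.\<close>

definition Ck_map_on :: "nat \<Rightarrow> ('x, 'e::euclidean_space) chart set \<Rightarrow>
    ('y, 'f::euclidean_space) chart set \<Rightarrow> 'x set \<Rightarrow> ('x \<Rightarrow> 'y) \<Rightarrow> bool" where
  "Ck_map_on k A B W F \<longleftrightarrow> (\<forall>c\<in>A. \<forall>d\<in>B.
     let S = snd c ` {x \<in> fst c \<inter> W. F x \<in> fst d}
     in open S \<and> Ck_on k (snd d \<circ> F \<circ> chart_inv c) S)"

definition smooth_map_on :: "('x, 'e::euclidean_space) chart set \<Rightarrow>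
    ('y, 'f::euclidean_space) chart set \<Rightarrow> 'x set \<Rightarrow> ('x \<Rightarrow> 'y) \<Rightarrow> bool" where
  "smooth_map_on A B W F \<longleftrightarrow> (\<forall>k. Ck_map_on k A B W F)"

definition diffeo_on :: "('x, 'e::euclidean_space) chart set \<Rightarrow>
    ('y, 'f::euclidean_space) chart set \<Rightarrow> 'x set \<Rightarrow> ('x \<Rightarrow> 'y) \<Rightarrow> bool" where
  "diffeo_on A B W F \<longleftrightarrow> inj_on F W \<and> smooth_map_on A B W F \<and>
     smooth_map_on B A (F ` W) (inv_into W F)"

text \<open>The standard atlas of a Euclidean space.\<close>

definition id_atlas :: "('e, 'e) chart set" where
  "id_atlas = {(UNIV, \<lambda>x. x)}"

section \<open>Tangent vectors\<close>

text \<open>For each point \<open>p\<close> a chart around \<open>p\<close> is selected, and the tangent space at \<open>p\<close> is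
  represented by the model space \<open>'e\<close>: \<open>v\<close> stands for the tangent vector at \<open>p\<close> whose components
  in the selected chart are \<open>v\<close>. Its components in another chart \<open>c\<close> are \<open>tcoord A c p v\<close>.
  The selection need not be continuous in \<open>p\<close>, so continuity and smoothness of maps on the tangent
  bundle are only expressed through \<open>tangent_atlas\<close>.\<close>

definition chart_at :: "('a, 'e) chart set \<Rightarrow> 'a \<Rightarrow> ('a, 'e) chart" where
  "chart_at A p = (SOME c. c \<in> A \<and> p \<in> fst c)"

definition tcoord :: "('a, 'e::euclidean_space) chart set \<Rightarrow> ('a, 'e) chart \<Rightarrow> 'a \<Rightarrow> 'e \<Rightarrow> 'e" where
  "tcoord A c p v =
     frechet_derivative (snd c \<circ> chart_inv (chart_at A p)) (at (snd (chart_at A p) p)) v"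

definition tangent_atlas ::
  "('a, 'e::euclidean_space) chart set \<Rightarrow> ('a \<times> 'e, 'e \<times> 'e) chart set" where
  "tangent_atlas A =
     (\<lambda>c. (fst c \<times> UNIV, \<lambda>(p, v). (snd c p, tcoord A c p v))) ` A"

text \<open>The atlas of the Whitney sum of the tangent bundle with itself.\<close>

definition tangent2_atlas ::
  "('a, 'e::euclidean_space) chart set \<Rightarrow> ('a \<times> 'e \<times> 'e, 'e \<times> 'e \<times> 'e) chart set" where
  "tangent2_atlas A =
     (\<lambda>c. (fst c \<times> UNIV \<times> UNIV, \<lambda>(p, v, w). (snd c p, tcoord A c p v, tcoord A c p w))) ` A"

definition differential ::
  "('a, 'e::euclidean_space) chart set \<Rightarrow> ('a \<Rightarrow> real) \<Rightarrow> 'a \<Rightarrow> 'e \<Rightarrow> real" where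
  "differential A f p v =
     frechet_derivative (f \<circ> chart_inv (chart_at A p)) (at (snd (chart_at A p) p)) v"

section \<open>Riemannian metrics and gradients\<close>

definition riemannian_manifold ::
  "('a::{t2_space,second_countable_topology}, 'e::euclidean_space) chart set \<Rightarrow>
    ('a \<Rightarrow> 'e \<Rightarrow> 'e \<Rightarrow> real) \<Rightarrow> bool" where
  "riemannian_manifold A g \<longleftrightarrow> smooth_atlas A \<and>
     (\<forall>p. bilinear (g p)) \<and> (\<forall>p v w. g p v w = g p w v) \<and> (\<forall>p v. v \<noteq> 0 \<longrightarrow> g p v v > 0) \<and>
     smooth_map_on (tangent2_atlas A) id_atlas UNIV (\<lambda>(p, v, w). g p v w)"

definition tnorm :: "('a \<Rightarrow> 'e \<Rightarrow> 'e \<Rightarrow> real) \<Rightarrow> 'a \<Rightarrow> 'e \<Rightarrow> real" where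
  "tnorm g p v = sqrt (g p v v)"

definition tball :: "('a \<Rightarrow> 'e \<Rightarrow> 'e \<Rightarrow> real) \<Rightarrow> 'a \<Rightarrow> real \<Rightarrow> 'e set" where
  "tball g p r = {v. tnorm g p v < r}"

definition grad :: "('a, 'e::euclidean_space) chart set \<Rightarrow> ('a \<Rightarrow> 'e \<Rightarrow> 'e \<Rightarrow> real) \<Rightarrow>
    ('a \<Rightarrow> real) \<Rightarrow> 'a \<Rightarrow> 'e" where
  "grad A g f p = (THE v. \<forall>w. g p v w = differential A f p w)"

section \<open>Retractions and vector transports\<close>

text \<open>\<open>R p v\<close> is the value of the retraction at the tangent vector \<open>v\<close> at \<open>p\<close>. The derivative of
  \<open>R p\<close> at \<open>0\<close> is computed in the chart selected at \<open>p\<close>, in which tangent vectors at \<open>p\<close> are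
  represented.\<close>

definition manifold_retraction ::
  "('a, 'e::euclidean_space) chart set \<Rightarrow> ('a \<Rightarrow> 'e \<Rightarrow> 'a) \<Rightarrow> bool" where
  "manifold_retraction A R \<longleftrightarrow>
     smooth_map_on (tangent_atlas A) A UNIV (\<lambda>(p, v). R p v) \<and>
     (\<forall>p. R p 0 = p) \<and>
     (\<forall>p. ((\<lambda>v. snd (chart_at A p) (R p v)) has_derivative (\<lambda>\<xi>. \<xi>)) (at 0))"

text \<open>\<open>T p \<eta> \<xi>\<close> is the transport of \<open>\<xi>\<close> along \<open>\<eta>\<close>, both tangent at \<open>p\<close>; it is a tangent vector
  at \<open>R p \<eta>\<close>.\<close>

definition vector_transport :: "('a, 'e::euclidean_space) chart set \<Rightarrow> ('a \<Rightarrow> 'e \<Rightarrow> 'a) \<Rightarrow>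
    ('a \<Rightarrow> 'e \<Rightarrow> 'e \<Rightarrow> 'e) \<Rightarrow> bool" where
  "vector_transport A R T \<longleftrightarrow>
     smooth_map_on (tangent2_atlas A) (tangent_atlas A) UNIV (\<lambda>(p, \<eta>, \<xi>). (R p \<eta>, T p \<eta> \<xi>)) \<and>
     (\<forall>p \<eta>. linear (T p \<eta>)) \<and>
     (\<forall>p \<xi>. T p 0 \<xi> = \<xi>)"

section \<open>The algorithm\<close>

definition batch_grad :: "('a, 'e::euclidean_space) chart set \<Rightarrow> ('a \<Rightarrow> 'e \<Rightarrow> 'e \<Rightarrow> real) \<Rightarrow>
    (nat \<Rightarrow> 'a \<Rightarrow> real) \<Rightarrow> nat set \<Rightarrow> 'a \<Rightarrow> 'e" where
  "batch_grad A g fs B p = (1 / real (card B)) *\<^sub>R (\<Sum>i\<in>B. grad A g (fs i) p)"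

text \<open>One trajectory of the algorithm for the choice \<open>J s t\<close> of index sets, where \<open>f\<close> is the mean
  of the \<open>fs i\<close>. Transport from \<open>\<omega> s (t-1)\<close> to \<open>\<omega> s t\<close> is along the step that was taken. Transport
  from \<open>\<omega> s 0\<close> to \<open>\<omega> s t\<close> is along the tangent vector of length less than \<open>\<rho>\<close> that the retraction
  maps to \<open>\<omega> s t\<close>, except for \<open>t = 1\<close>, where it is the same transport as the former.\<close>

definition rshg_run :: "('a, 'e::euclidean_space) chart set \<Rightarrow> ('a \<Rightarrow> 'e \<Rightarrow> 'e \<Rightarrow> real) \<Rightarrow>
    ('a \<Rightarrow> 'e \<Rightarrow> 'a) \<Rightarrow> ('a \<Rightarrow> 'e \<Rightarrow> 'e \<Rightarrow> 'e) \<Rightarrow> real \<Rightarrow> (nat \<Rightarrow> 'a \<Rightarrow> real) \<Rightarrow> ('a \<Rightarrow> real) \<Rightarrow>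
    (nat \<Rightarrow> nat \<Rightarrow> real) \<Rightarrow> (nat \<Rightarrow> nat \<Rightarrow> real) \<Rightarrow> (nat \<Rightarrow> nat \<Rightarrow> real) \<Rightarrow> real \<Rightarrow> nat \<Rightarrow> 'a \<Rightarrow>
    (nat \<Rightarrow> nat \<Rightarrow> nat set) \<Rightarrow> (nat \<Rightarrow> nat \<Rightarrow> 'a) \<Rightarrow> (nat \<Rightarrow> nat \<Rightarrow> 'e) \<Rightarrow> bool" where
  "rshg_run A g R T \<rho> fs f \<alpha> \<phi> \<psi> \<mu> m \<omega>init J \<omega> V \<longleftrightarrow> (\<forall>s\<ge>1.
     \<omega> s 0 = (if s = 1 then \<omega>init else \<omega> (s - 1) m) \<and>
     V s 0 = grad A g f (\<omega> s 0) \<and>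
     (\<forall>t<m. \<omega> s (t + 1) = R (\<omega> s t) (- (\<alpha> s t *\<^sub>R V s t))) \<and>
     (\<forall>t\<in>{1..<m}.
       let gB = batch_grad A g fs (J s t);
           gf = grad A g f;
           step = - (\<alpha> s (t - 1) *\<^sub>R V s (t - 1));
           \<eta> = (if t = 1 then step
                else inv_into (tball g (\<omega> s 0) \<rho>) (R (\<omega> s 0)) (\<omega> s t));
           Tprev = T (\<omega> s (t - 1)) step;
           T0 = T (\<omega> s 0) \<eta>;
           D = g (\<omega> s t) (Tprev (V s (t - 1) - gf (\<omega> s (t - 1)))) (gf (\<omega> s t));
           \<psi>' = (if D \<noteq> 0 then min (\<psi> s t) (\<mu> * (tnorm g (\<omega> s t) (gf (\<omega> s t)))\<^sup>2 / \<bar>D\<bar>)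
                else \<psi> s t)
       in V s t =
            \<phi> s t *\<^sub>R (gB (\<omega> s t) - T0 (gB (\<omega> s 0) - gf (\<omega> s 0))) +
            \<psi>' *\<^sub>R (gB (\<omega> s t) - Tprev (gB (\<omega> s (t - 1)) - V s (t - 1))) +
            (1 - \<phi> s t - \<psi>') *\<^sub>R gB (\<omega> s t)))"

end

theory Submission
  imports Defs
begin

text \<open>
  Enumerate the iterates as a single sequence \<open>w\<^sub>k\<close>, with directions \<open>v\<^sub>k\<close> and step sizes \<open>a\<^sub>k\<close>,
  and let \<open>N\<^sub>k\<close> be the squared norm of the gradient of \<open>f\<close> at \<open>w\<^sub>k\<close>.

  Averaging a batch gradient over all index sets of the given cardinality yields the full gradient.
  Hence the mean of \<open>v\<^sub>k\<close> over the choice made at step \<open>k\<close> is the gradient plus the weight times a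
  transported error of the preceding step, and the truncation of the weight is designed so that the
  pairing of this mean with the gradient is at least \<open>(1 - \<mu>) N\<^sub>k\<close> (lemmas
  \<open>sum_direction_inner_gradient\<close> and \<open>drift_bounds\<close>). An epoch starts with the full gradient, and
  by isometry of the transport the length of the direction grows at most by a constant at each of
  its \<open>m\<close> steps, so the directions are bounded (\<open>directions_bounded\<close>). On the compact set that contains the iterates, a second-order Taylor
  expansion in finitely many charts gives constants for a descent inequality along the retraction and
  for the variation of the squared gradient norm (\<open>descent_on_compact\<close>). Altogether
  \<open>f(w\<^sub>k\<^sub>+\<^sub>1) \<le> f(w\<^sub>k) - (1 - \<mu>) a\<^sub>k N\<^sub>k - a\<^sub>k \<xi>\<^sub>k + c a\<^sub>k\<^sup>2\<close> and
  \<open>\<bar>N\<^sub>k\<^sub>+\<^sub>1 - N\<^sub>k\<bar> \<le> c a\<^sub>k\<close>,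
  where \<open>\<xi>\<^sub>k\<close> is bounded and has mean zero given the past.

  The noise \<open>\<Sum>a\<^sub>k \<xi>\<^sub>k\<close> is a martingale with summable variances, so it converges almost surely by
  Kolmogorov's maximal inequality (\<open>innovation_series_summable\<close>). Up to each step only finitely many
  outcomes are possible, and mean zero given the past is expressed by saying
  that the expectation against every function of the past choices vanishes. What remains is a
  statement on real sequences (\<open>descent_sequence_converges\<close>): \<open>f(w\<^sub>k)\<close> converges and \<open>\<Sum>a\<^sub>k N\<^sub>k\<close>
  is finite; the Lipschitz bound on \<open>N\<close> then makes the increments of \<open>N\<^sup>2\<close> summable, so that \<open>N\<^sub>k\<close>
  has a limit, and the divergence of \<open>\<Sum>a\<^sub>k\<close> leaves only the limit zero.
\<close>

section \<open>Lipschitz and Taylor estimates for functions of class \<open>C\<^sup>k\<close>\<close>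

lemma Ck_on_imp_continuous_on:
  assumes "Ck_on k f S"
  shows "continuous_on S f"
proof (cases k)
  case (Suc l)
  then have "\<forall>x\<in>S. f differentiable (at x)" using assms by simp
  then show ?thesis
    by (blast intro: continuous_at_imp_continuous_on differentiable_imp_continuous_within)
qed (use assms in simp)

lemma Ck_on_Suc_imp: "Ck_on (Suc k) f S \<Longrightarrow> Ck_on k f S"
proof (induction k arbitrary: f)
  case 0
  then show ?case using Ck_on_imp_continuous_on[of "Suc 0" f S] by simp
next
  case (Suc k)
  have "\<forall>x\<in>S. f differentiable (at x)"
    "Ck_on (Suc k) (\<lambda>x. frechet_derivative f (at x) v) S" for v
    using Suc.prems unfolding Ck_on.simps(2)[of "Suc k"] by blast+
  then show ?case using Suc.IH by (simp only: Ck_on.simps) blast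
qed

lemma norm_linear_le_Basis:
  fixes D :: "'e::euclidean_space \<Rightarrow> 'f::real_normed_vector"
  assumes "linear D" and "\<And>b. b \<in> Basis \<Longrightarrow> norm (D b) \<le> B b"
  shows "norm (D v) \<le> sum B Basis * norm v"
proof -
  have "D v = D (\<Sum>b\<in>Basis. (v \<bullet> b) *\<^sub>R b)" by (simp add: euclidean_representation)
  also have "\<dots> = (\<Sum>b\<in>Basis. (v \<bullet> b) *\<^sub>R D b)"
    using assms(1) by (simp add: linear_sum linear_cmul)
  finally have "norm (D v) \<le> (\<Sum>b\<in>Basis. norm ((v \<bullet> b) *\<^sub>R D b))"
    by (simp only: norm_sum)
  also have "\<dots> \<le> (\<Sum>b\<in>Basis. norm v * B b)"
  proof (rule sum_mono)
    fix b :: 'e assume b: "b \<in> Basis"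
    show "norm ((v \<bullet> b) *\<^sub>R D b) \<le> norm v * B b"
      unfolding norm_scaleR using Basis_le_norm[OF b] assms(2)[OF b] by (intro mult_mono) auto
  qed
  finally show ?thesis by (simp add: sum_distrib_left mult.commute)
qed

text \<open>The class is defined through directional derivatives, so the operator norm of the derivative
  is controlled by the finitely many continuous functions that arise from a basis.\<close>

lemma Ck1_locally_Lipschitz:
  fixes F :: "'e::euclidean_space \<Rightarrow> 'f::real_normed_vector"
  assumes F: "Ck_on 1 F S" and S: "open S" "x0 \<in> S"
  obtains r L where "r > 0" "L \<ge> 0" "ball x0 r \<subseteq> S"
    "\<And>x v. x \<in> ball x0 r \<Longrightarrow> norm (frechet_derivative F (at x) v) \<le> L * norm v"
    "\<And>x y. x \<in> ball x0 r \<Longrightarrow> y \<in> ball x0 r \<Longrightarrow> norm (F x - F y) \<le> L * norm (x - y)"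
proof -
  let ?D = "\<lambda>x. frechet_derivative F (at x)"
  define M where "M = (\<lambda>x. \<Sum>b\<in>Basis. norm (?D x b))"
  have D: "(F has_derivative ?D x) (at x)" if "x \<in> S" for x
    using F that by (simp add: frechet_derivative_works)
  have "continuous_on S M"
    unfolding M_def using F by (intro continuous_on_sum continuous_on_norm) simp
  then have "isCont M x0" using S by (simp add: continuous_on_eq_continuous_at)
  then have "\<forall>\<^sub>F x in nhds x0. M x < M x0 + 1"
    unfolding isCont_def by (intro order_tendstoD) (auto simp: tendsto_at_iff_tendsto_nhds)
  moreover have "\<forall>\<^sub>F x in nhds x0. x \<in> S" using S by (rule eventually_nhds_in_open)
  ultimately have "\<forall>\<^sub>F x in nhds x0. M x < M x0 + 1 \<and> x \<in> S" by eventually_elim auto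
  then obtain r where r: "r > 0" "\<And>x. dist x x0 < r \<Longrightarrow> M x < M x0 + 1 \<and> x \<in> S"
    unfolding eventually_nhds_metric by blast
  have M0: "M x0 + 1 \<ge> 0" by (simp add: M_def add_nonneg_nonneg sum_nonneg)
  have *: "norm (?D x v) \<le> (M x0 + 1) * norm v" if "x \<in> ball x0 r" for x v
  proof -
    have x: "x \<in> S" "M x < M x0 + 1" using r that by (auto simp: dist_commute)
    have "norm (?D x v) \<le> M x * norm v"
      unfolding M_def using D[OF x(1)]
      by (intro norm_linear_le_Basis) (auto dest: has_derivative_linear)
    also have "\<dots> \<le> (M x0 + 1) * norm v" using x by (intro mult_right_mono) auto
    finally show ?thesis .
  qed
  have sub: "ball x0 r \<subseteq> S" using r by (auto simp: dist_commute)
  show ?thesis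
  proof (rule that[OF r(1) M0 sub *])
    fix x y assume xy: "x \<in> ball x0 r" "y \<in> ball x0 r"
    show "norm (F x - F y) \<le> (M x0 + 1) * norm (x - y)"
    proof (rule differentiable_bound[where S = "ball x0 r" and f' = ?D])
      show "(F has_derivative ?D z) (at z within ball x0 r)" if "z \<in> ball x0 r" for z
        using D sub that by (blast intro: has_derivative_at_withinI)
      show "onorm (?D z) \<le> M x0 + 1" if "z \<in> ball x0 r" for z
        using * M0 that by (intro onorm_bound) auto
    qed (use xy in auto)
  qed
qed

text \<open>The derivative is locally Lipschitz because its values on a basis are of class \<open>C\<^sup>1\<close>; the
  Taylor remainder at \<open>x\<close> is then the increment of \<open>\<lambda>z. F z - F'(x) z\<close>, whose derivative on the
  segment is at most \<open>L\<close> times its length. The base point \<open>x\<close> ranges over the whole ball, which is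
  what later makes the constants uniform on a compact set.\<close>

lemma Ck2_local_Taylor:
  fixes F :: "'e::euclidean_space \<Rightarrow> 'f::real_normed_vector"
  assumes F: "Ck_on 2 F S" and S: "open S" "x0 \<in> S"
  obtains r L where "r > 0" "L \<ge> 0" "ball x0 r \<subseteq> S"
    "\<And>x y v. x \<in> ball x0 r \<Longrightarrow> y \<in> ball x0 r \<Longrightarrow>
       norm (frechet_derivative F (at y) v - frechet_derivative F (at x) v)
         \<le> L * norm (y - x) * norm v"
    "\<And>x y. x \<in> ball x0 r \<Longrightarrow> y \<in> ball x0 r \<Longrightarrow>
       norm (F y - F x - frechet_derivative F (at x) (y - x)) \<le> L * (norm (y - x))\<^sup>2"
proof -
  let ?D = "\<lambda>x. frechet_derivative F (at x)"
  have F': "\<And>x. x \<in> S \<Longrightarrow> F differentiable (at x)" "\<And>v. Ck_on 1 (\<lambda>x. ?D x v) S"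
    using F by (simp_all add: numeral_2_eq_2)
  have D: "(F has_derivative ?D x) (at x)" if "x \<in> S" for x
    using F' that by (simp add: frechet_derivative_works)
  have "\<forall>b\<in>Basis. \<exists>r L. r > 0 \<and> L \<ge> 0 \<and> ball x0 r \<subseteq> S \<and>
      (\<forall>x\<in>ball x0 r. \<forall>y\<in>ball x0 r. norm (?D x b - ?D y b) \<le> L * norm (x - y))"
  proof
    fix b :: 'e
    obtain r L where "r > 0" "L \<ge> 0" "ball x0 r \<subseteq> S"
      "\<And>x y. x \<in> ball x0 r \<Longrightarrow> y \<in> ball x0 r \<Longrightarrow> norm (?D x b - ?D y b) \<le> L * norm (x - y)"
      by (rule Ck1_locally_Lipschitz[OF F'(2)[of b] S]) blast
    then show "\<exists>r L. r > 0 \<and> L \<ge> 0 \<and> ball x0 r \<subseteq> S \<and>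
      (\<forall>x\<in>ball x0 r. \<forall>y\<in>ball x0 r. norm (?D x b - ?D y b) \<le> L * norm (x - y))" by blast
  qed
  then obtain rr LL where rL: "\<And>b. b \<in> Basis \<Longrightarrow> rr b > 0 \<and> LL b \<ge> 0 \<and> ball x0 (rr b) \<subseteq> S \<and>
      (\<forall>x\<in>ball x0 (rr b). \<forall>y\<in>ball x0 (rr b). norm (?D x b - ?D y b) \<le> LL b * norm (x - y))"
    by metis
  define r where "r = Min (rr ` Basis)"
  define L where "L = sum LL Basis"
  have r: "r > 0" "\<And>b. b \<in> Basis \<Longrightarrow> r \<le> rr b"
    unfolding r_def using rL by auto
  have sub: "ball x0 r \<subseteq> S"
  proof -
    obtain b :: 'e where b: "b \<in> Basis" using nonempty_Basis by blast
    show ?thesis using r(2)[OF b] rL[OF b] by (meson subset_ball subset_trans)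
  qed
  have L: "L \<ge> 0" unfolding L_def using rL by (auto intro: sum_nonneg)
  have Lip: "norm (?D y v - ?D x v) \<le> L * norm (y - x) * norm v"
    if xy: "x \<in> ball x0 r" "y \<in> ball x0 r" for x y v
  proof -
    have lin: "linear (\<lambda>v. ?D y v - ?D x v)"
      using xy sub D by (intro linear_compose_sub has_derivative_linear[OF D]) auto
    have "norm (?D y v - ?D x v) \<le> (\<Sum>b\<in>Basis. LL b * norm (y - x)) * norm v"
    proof (rule norm_linear_le_Basis[OF lin])
      fix b :: 'e assume b: "b \<in> Basis"
      have "x \<in> ball x0 (rr b)" "y \<in> ball x0 (rr b)" using xy r(2)[OF b] by auto
      then show "norm (?D y b - ?D x b) \<le> LL b * norm (y - x)" using rL[OF b] by blast
    qed
    then show ?thesis by (simp add: L_def sum_distrib_right)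
  qed
  show ?thesis
  proof (rule that[OF r(1) L sub Lip])
    fix x y assume xy: "x \<in> ball x0 r" "y \<in> ball x0 r"
    have seg: "closed_segment x y \<subseteq> ball x0 r"
      using xy by (simp add: closed_segment_subset)
    have "norm ((F y - ?D x y) - (F x - ?D x x)) \<le> (L * norm (y - x)) * norm (y - x)"
    proof (rule differentiable_bound[where S = "closed_segment x y"
            and f' = "\<lambda>z v. ?D z v - ?D x v"])
      fix z assume z: "z \<in> closed_segment x y"
      have zb: "z \<in> ball x0 r" using z seg by auto
      have bl: "bounded_linear (?D x)" using D xy sub by (blast dest: has_derivative_bounded_linear)
      show "((\<lambda>z. F z - ?D x z) has_derivative (\<lambda>v. ?D z v - ?D x v)) (at z within closed_segment x y)"
        using zb sub
        by (intro has_derivative_diff bounded_linear_imp_has_derivative bl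
             has_derivative_at_withinI[OF D]) auto
      show "onorm (\<lambda>v. ?D z v - ?D x v) \<le> L * norm (y - x)"
      proof (rule onorm_bound)
        fix v
        have "norm (?D z v - ?D x v) \<le> L * norm (z - x) * norm v" using Lip xy zb by blast
        also have "\<dots> \<le> L * norm (y - x) * norm v"
          using segment_bound(1)[OF z] L by (intro mult_right_mono mult_left_mono) auto
        finally show "norm (?D z v - ?D x v) \<le> L * norm (y - x) * norm v" .
      qed (use L in auto)
    qed auto
    moreover
    have "?D x (y - x) = ?D x y - ?D x x"
      using xy sub by (intro linear_diff has_derivative_linear[OF D]) auto
    then have "F y - F x - ?D x (y - x) = (F y - ?D x y) - (F x - ?D x x)"
      by simp
    ultimately show "norm (F y - F x - ?D x (y - x)) \<le> L * (norm (y - x))\<^sup>2"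
      by (simp only: power2_eq_square mult.assoc)
  qed
qed

section \<open>Tangent vectors in charts\<close>

context
  fixes A :: "('a::{t2_space,second_countable_topology}, 'e::euclidean_space) chart set"
  assumes atlas: "smooth_atlas A"
begin

lemma chart_at: "chart_at A p \<in> A" "p \<in> fst (chart_at A p)"
proof -
  have "\<exists>c. c \<in> A \<and> p \<in> fst c" using atlas unfolding smooth_atlas_def by blast
  then have "chart_at A p \<in> A \<and> p \<in> fst (chart_at A p)"
    unfolding chart_at_def by (rule someI_ex)
  then show "chart_at A p \<in> A" "p \<in> fst (chart_at A p)" by auto
qed

lemma chart_homeomorphism:
  assumes "c \<in> A"
  shows "open (fst c)" "open (snd c ` fst c)"
    "homeomorphism (fst c) (snd c ` fst c) (snd c) (chart_inv c)"
  using atlas assms unfolding smooth_atlas_def by blast+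

lemma chart_inv_chart: "c \<in> A \<Longrightarrow> p \<in> fst c \<Longrightarrow> chart_inv c (snd c p) = p"
  using chart_homeomorphism(3) homeomorphism_apply1 by blast

lemma open_chart_image:
  assumes c: "c \<in> A" and W: "open W"
  shows "open (snd c ` (fst c \<inter> W))"
proof -
  have "snd c ` (fst c \<inter> W) = snd c ` fst c \<inter> chart_inv c -` W"
    by (auto simp: chart_inv_chart[OF c])
  moreover have "continuous_on (snd c ` fst c) (chart_inv c)"
    using chart_homeomorphism(3)[OF c] by (simp add: homeomorphism_def)
  ultimately show ?thesis
    using chart_homeomorphism(2)[OF c] W by (simp add: continuous_open_preimage)
qed

lemma open_chart_preimage:
  assumes c: "c \<in> A" and W: "open W"
  shows "open (fst c \<inter> snd c -` W)"
proof -
  have "continuous_on (fst c) (snd c)"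
    using chart_homeomorphism(3)[OF c] by (simp add: homeomorphism_def)
  then show ?thesis
    using chart_homeomorphism(1)[OF c] W by (simp add: continuous_open_preimage)
qed

text \<open>Differentials of chart transitions. Components of a tangent vector refer to the chart selected at
  its base point, so \<open>tcoord\<close> is one such differential, and its inverse is the differential of the
  opposite transition.\<close>

definition trans_deriv :: "('a, 'e) chart \<Rightarrow> ('a, 'e) chart \<Rightarrow> 'a \<Rightarrow> 'e \<Rightarrow> 'e" where
  "trans_deriv c d p = frechet_derivative (snd d \<circ> chart_inv c) (at (snd c p))"

definition tcoord_inv :: "('a, 'e) chart \<Rightarrow> 'a \<Rightarrow> 'e \<Rightarrow> 'e" where
  "tcoord_inv c p = trans_deriv c (chart_at A p) p"

lemma tcoord_eq_trans_deriv: "tcoord A c p = trans_deriv (chart_at A p) c p"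
  by (simp add: fun_eq_iff tcoord_def trans_deriv_def)

lemma has_derivative_trans_deriv:
  assumes "c \<in> A" "d \<in> A" "p \<in> fst c" "p \<in> fst d"
  shows "((snd d \<circ> chart_inv c) has_derivative trans_deriv c d p) (at (snd c p))"
proof -
  have "Ck_on (Suc 0) (snd d \<circ> chart_inv c) (snd c ` (fst c \<inter> fst d))"
    using atlas assms(1,2) unfolding smooth_atlas_def by blast
  then have "(snd d \<circ> chart_inv c) differentiable (at (snd c p))"
    using assms(3,4) by simp
  then show ?thesis by (simp add: trans_deriv_def frechet_derivative_works)
qed

lemma has_derivative_change_chart:
  fixes F :: "'a \<Rightarrow> 'f::real_normed_vector"
  assumes c: "c \<in> A" "p \<in> fst c" and d: "d \<in> A" "p \<in> fst d"
    and F: "((F \<circ> chart_inv c) has_derivative F') (at (snd c p))"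
  shows "((F \<circ> chart_inv d) has_derivative (F' \<circ> trans_deriv d c p)) (at (snd d p))"
proof -
  have "((F \<circ> chart_inv c) \<circ> (snd c \<circ> chart_inv d) has_derivative (F' \<circ> trans_deriv d c p))
      (at (snd d p))"
    using F by (intro diff_chain_at has_derivative_trans_deriv c d)
      (simp add: chart_inv_chart[OF d])
  moreover have "open (snd d ` (fst d \<inter> fst c))"
    using open_chart_image[OF d(1)] chart_homeomorphism(1)[OF c(1)] by blast
  ultimately show ?thesis
  proof (rule has_derivative_transform_within_open)
    show "snd d p \<in> snd d ` (fst d \<inter> fst c)" using c d by blast
    show "((F \<circ> chart_inv c) \<circ> (snd c \<circ> chart_inv d)) y = (F \<circ> chart_inv d) y"
      if "y \<in> snd d ` (fst d \<inter> fst c)" for y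
      using that by (auto simp: chart_inv_chart[OF d(1)] chart_inv_chart[OF c(1)])
  qed
qed

lemma linear_trans_deriv:
  "c \<in> A \<Longrightarrow> d \<in> A \<Longrightarrow> p \<in> fst c \<Longrightarrow> p \<in> fst d \<Longrightarrow> linear (trans_deriv c d p)"
  using has_derivative_trans_deriv has_derivative_linear by blast

lemma trans_deriv_compose:
  assumes "c \<in> A" "d \<in> A" "e \<in> A" "p \<in> fst c" "p \<in> fst d" "p \<in> fst e"
  shows "trans_deriv d e p (trans_deriv c d p v) = trans_deriv c e p v"
proof -
  have "((snd e \<circ> chart_inv c) has_derivative (trans_deriv d e p \<circ> trans_deriv c d p)) (at (snd c p))"
    using assms by (intro has_derivative_change_chart[of d] has_derivative_trans_deriv)
  then have "trans_deriv d e p \<circ> trans_deriv c d p = trans_deriv c e p"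
    using has_derivative_trans_deriv[of c e p] assms has_derivative_unique by blast
  then show ?thesis by (metis comp_apply)
qed

lemma trans_deriv_refl:
  assumes "c \<in> A" "p \<in> fst c"
  shows "trans_deriv c c p v = v"
proof -
  have "((\<lambda>y. y) has_derivative (\<lambda>y. y)) (at (snd c p))" by simp
  moreover have "open (snd c ` fst c)" using chart_homeomorphism(2) assms by blast
  ultimately have "((snd c \<circ> chart_inv c) has_derivative (\<lambda>y. y)) (at (snd c p))"
  proof (rule has_derivative_transform_within_open)
    show "snd c p \<in> snd c ` fst c" using assms by blast
    show "y = (snd c \<circ> chart_inv c) y" if "y \<in> snd c ` fst c" for y
      using that by (auto simp: chart_inv_chart[OF assms(1)])
  qed
  then have "(\<lambda>y. y) = trans_deriv c c p"
    using has_derivative_trans_deriv[of c c p] assms has_derivative_unique by blast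
  then show ?thesis by metis
qed

lemma
  assumes "c \<in> A" "p \<in> fst c"
  shows linear_tcoord: "linear (tcoord A c p)"
    and linear_tcoord_inv: "linear (tcoord_inv c p)"
    and tcoord_tcoord_inv: "tcoord A c p (tcoord_inv c p v) = v"
    and tcoord_inv_tcoord: "tcoord_inv c p (tcoord A c p v) = v"
  unfolding tcoord_eq_trans_deriv tcoord_inv_def
  using assms chart_at[of p]
  by (simp_all add: linear_trans_deriv trans_deriv_compose trans_deriv_refl)

lemma tcoord_eq_0_iff:
  assumes "c \<in> A" "p \<in> fst c"
  shows "tcoord A c p v = 0 \<longleftrightarrow> v = 0"
  using linear_0[OF linear_tcoord[OF assms]] linear_0[OF linear_tcoord_inv[OF assms]]
    tcoord_inv_tcoord[OF assms] by metis

lemma tcoord_chart_at: "tcoord A (chart_at A p) p v = v"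
  by (simp add: tcoord_eq_trans_deriv trans_deriv_refl chart_at)

lemma differential_in_chart:
  assumes c: "c \<in> A" "p \<in> fst c"
    and F: "((F \<circ> chart_inv c) has_derivative F') (at (snd c p))"
  shows "differential A F p v = F' (tcoord A c p v)"
proof -
  have "((F \<circ> chart_inv (chart_at A p)) has_derivative (F' \<circ> tcoord A c p))
      (at (snd (chart_at A p) p))"
    unfolding tcoord_eq_trans_deriv using c F by (intro has_derivative_change_chart chart_at)
  then show ?thesis
    unfolding differential_def using frechet_derivative_at by (metis comp_apply)
qed

lemma Ck_map_on_in_chart:
  fixes F :: "'a \<Rightarrow> real"
  assumes "Ck_map_on k A id_atlas UNIV F" "c \<in> A"
  shows "Ck_on k (F \<circ> chart_inv c) (snd c ` fst c)"
proof -
  have "Ck_on k ((\<lambda>x. x) \<circ> F \<circ> chart_inv c) (snd c ` fst c)"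
    using assms unfolding Ck_map_on_def id_atlas_def by (auto simp: Let_def)
  then show ?thesis by (simp add: comp_def)
qed

lemma linear_differential:
  assumes "Ck_map_on (Suc k) A id_atlas UNIV F"
  shows "linear (differential A F p)"
proof -
  let ?c = "chart_at A p"
  have "(F \<circ> chart_inv ?c) differentiable (at (snd ?c p))"
    using Ck_map_on_in_chart[OF assms chart_at(1)] chart_at(2) by simp
  then have "linear (frechet_derivative (F \<circ> chart_inv ?c) (at (snd ?c p)))"
    by (rule linear_frechet_derivative)
  then show ?thesis unfolding differential_def[abs_def] by simp
qed

text \<open>Charts of the tangent bundle are inverted by \<open>inv_into\<close>; evaluating that inverse is what turns
  smoothness on the bundle into smoothness of an ordinary function on a Euclidean space.\<close>

lemma tangent2_chart_inv:
  assumes c: "c \<in> A" "p \<in> fst c"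
  shows "chart_inv (fst c \<times> UNIV \<times> UNIV, \<lambda>(p, v, w). (snd c p, tcoord A c p v, tcoord A c p w))
    (snd c p, tcoord A c p v, tcoord A c p w) = (p, v, w)"
proof -
  let ?\<Psi> = "\<lambda>(p, v, w). (snd c p, tcoord A c p v, tcoord A c p w)"
  have "inj_on ?\<Psi> (fst c \<times> UNIV \<times> UNIV)"
  proof (rule inj_onI, clarsimp)
    fix p v w q v' w'
    assume h: "p \<in> fst c" "q \<in> fst c" "snd c p = snd c q"
      "tcoord A c p v = tcoord A c q v'" "tcoord A c p w = tcoord A c q w'"
    then have "p = q" using chart_inv_chart[OF c(1)] by metis
    then show "p = q \<and> v = v' \<and> w = w'" using h tcoord_inv_tcoord[OF c(1)] by metis
  qed
  from inv_into_f_f[OF this, of "(p, v, w)"] show ?thesis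
    using c by (simp add: chart_inv_def)
qed

lemma tangent_chart_inv:
  assumes c: "c \<in> A" "p \<in> fst c"
  shows "chart_inv (fst c \<times> UNIV, \<lambda>(p, v). (snd c p, tcoord A c p v))
    (snd c p, tcoord A c p v) = (p, v)"
proof -
  let ?\<Psi> = "\<lambda>(p, v). (snd c p, tcoord A c p v)"
  have "inj_on ?\<Psi> (fst c \<times> UNIV)"
  proof (rule inj_onI, clarsimp)
    fix p v q v'
    assume h: "p \<in> fst c" "q \<in> fst c" "snd c p = snd c q" "tcoord A c p v = tcoord A c q v'"
    then have "p = q" using chart_inv_chart[OF c(1)] by metis
    then show "p = q \<and> v = v'" using h tcoord_inv_tcoord[OF c(1)] by metis
  qed
  from inv_into_f_f[OF this, of "(p, v)"] show ?thesis
    using c by (simp add: chart_inv_def)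
qed

section \<open>The metric and the retraction in a chart\<close>

lemma metric_in_chart:
  assumes g: "riemannian_manifold A g" and c: "c \<in> A"
  obtains G where "Ck_on 2 G (snd c ` fst c \<times> UNIV \<times> UNIV)"
    "\<And>p v w. p \<in> fst c \<Longrightarrow> G (snd c p, tcoord A c p v, tcoord A c p w) = g p v w"
proof -
  let ?\<Psi> = "\<lambda>(p, v, w). (snd c p, tcoord A c p v, tcoord A c p w)"
  let ?C = "(fst c \<times> (UNIV :: 'e set) \<times> (UNIV :: 'e set), ?\<Psi>)"
  define G where "G = snd (UNIV :: real set, \<lambda>x. x) \<circ> (\<lambda>(p, v, w). g p v w) \<circ> chart_inv ?C"
  have C: "?C \<in> tangent2_atlas A" unfolding tangent2_atlas_def using c by blast
  have "Ck_map_on 2 (tangent2_atlas A) id_atlas UNIV (\<lambda>(p, v, w). g p v w)"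
    using g unfolding riemannian_manifold_def smooth_map_on_def by blast
  then have "Ck_on 2 G (snd ?C ` {x \<in> fst ?C \<inter> UNIV. (\<lambda>(p, v, w). g p v w) x \<in> UNIV})"
    unfolding Ck_map_on_def G_def id_atlas_def Let_def using C by force
  moreover have "snd ?C ` {x \<in> fst ?C \<inter> UNIV. (\<lambda>(p, v, w). g p v w) x \<in> UNIV}
      = snd c ` fst c \<times> UNIV \<times> UNIV"
  proof (intro equalityI subsetI)
    fix z assume "z \<in> snd c ` fst c \<times> (UNIV :: 'e set) \<times> (UNIV :: 'e set)"
    then obtain p u w where z: "z = (snd c p, u, w)" "p \<in> fst c" by auto
    then have "z = ?\<Psi> (p, tcoord_inv c p u, tcoord_inv c p w)"
      by (simp add: tcoord_tcoord_inv[OF c])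
    then show "z \<in> snd ?C ` {x \<in> fst ?C \<inter> UNIV. (\<lambda>(p, v, w). g p v w) x \<in> UNIV}"
      using z(2) by (intro image_eqI[of _ _ "(p, tcoord_inv c p u, tcoord_inv c p w)"]) auto
  qed auto
  ultimately have "Ck_on 2 G (snd c ` fst c \<times> UNIV \<times> UNIV)" by simp
  moreover have "G (snd c p, tcoord A c p v, tcoord A c p w) = g p v w" if "p \<in> fst c" for p v w
    unfolding G_def by (simp add: tangent2_chart_inv[OF c that] del: UNIV_Times_UNIV)
  ultimately show ?thesis by (rule that)
qed

lemma retraction_in_chart:
  assumes R: "manifold_retraction A R" and c: "c \<in> A"
  obtains S \<sigma> where "open S" "Ck_on 2 \<sigma> S"
    "\<And>p v. p \<in> fst c \<Longrightarrow> (snd c p, tcoord A c p v) \<in> S \<longleftrightarrow> R p v \<in> fst c"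
    "\<And>p v. p \<in> fst c \<Longrightarrow> \<sigma> (snd c p, tcoord A c p v) = snd c (R p v)"
proof -
  let ?\<Psi> = "\<lambda>(p, v). (snd c p, tcoord A c p v)"
  let ?C = "(fst c \<times> (UNIV :: 'e set), ?\<Psi>)"
  define \<sigma> where "\<sigma> = snd c \<circ> (\<lambda>(p, v). R p v) \<circ> chart_inv ?C"
  define S where "S = snd ?C ` {x \<in> fst ?C \<inter> UNIV. (\<lambda>(p, v). R p v) x \<in> fst c}"
  have C: "?C \<in> tangent_atlas A" unfolding tangent_atlas_def using c by blast
  have R': "Ck_map_on 2 (tangent_atlas A) A UNIV (\<lambda>(p, v). R p v)"
    using R unfolding manifold_retraction_def smooth_map_on_def by blast
  have "open S \<and> Ck_on 2 \<sigma> S"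
    using bspec[OF bspec[OF R'[unfolded Ck_map_on_def Let_def] C] c]
    unfolding \<sigma>_def S_def .
  moreover have "(snd c p, tcoord A c p v) \<in> S \<longleftrightarrow> R p v \<in> fst c" if p: "p \<in> fst c" for p v
  proof
    assume "(snd c p, tcoord A c p v) \<in> S"
    then obtain q w where q: "q \<in> fst c" "R q w \<in> fst c"
      "snd c p = snd c q" "tcoord A c p v = tcoord A c q w"
      unfolding S_def by auto
    have "(q, w) = chart_inv ?C (snd c p, tcoord A c p v)"
      unfolding q(3,4) by (rule tangent_chart_inv[OF c q(1), symmetric])
    also have "\<dots> = (p, v)" by (rule tangent_chart_inv[OF c p])
    finally show "R p v \<in> fst c" using q by simp
  next
    assume "R p v \<in> fst c"
    then show "(snd c p, tcoord A c p v) \<in> S"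
      unfolding S_def using p by (intro image_eqI[of _ _ "(p, v)"]) auto
  qed
  moreover have "\<sigma> (snd c p, tcoord A c p v) = snd c (R p v)" if "p \<in> fst c" for p v
    unfolding \<sigma>_def by (simp add: tangent_chart_inv[OF c that])
  ultimately show ?thesis by (intro that) auto
qed

text \<open>Ellipticity comes from the positive minimum of the metric on a compact set of unit vectors.
  For the Lipschitz estimate, joint smoothness gives it for vectors of one small fixed length, and
  bilinearity extends it to all vectors.\<close>

lemma metric_local_bounds:
  assumes g: "riemannian_manifold A g" and c: "c \<in> A" "p0 \<in> fst c"
  obtains r l L where "r > 0" "l > 0" "L \<ge> 0"
    "\<And>p v. p \<in> fst c \<Longrightarrow> snd c p \<in> ball (snd c p0) r \<Longrightarrow> l * (norm (tcoord A c p v))\<^sup>2 \<le> g p v v"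
    "\<And>p q u w. p \<in> fst c \<Longrightarrow> snd c p \<in> ball (snd c p0) r \<Longrightarrow>
       q \<in> fst c \<Longrightarrow> snd c q \<in> ball (snd c p0) r \<Longrightarrow>
       \<bar>g p (tcoord_inv c p u) (tcoord_inv c p w) - g q (tcoord_inv c q u) (tcoord_inv c q w)\<bar>
         \<le> L * norm (snd c p - snd c q) * norm u * norm w"
proof -
  let ?Y = "snd c ` fst c" and ?y0 = "snd c p0"
  obtain G where G: "Ck_on 2 G (?Y \<times> UNIV \<times> UNIV)"
    and Gg: "\<And>p v w. p \<in> fst c \<Longrightarrow> G (snd c p, tcoord A c p v, tcoord A c p w) = g p v w"
    using metric_in_chart[OF g c(1)] by metis
  have Gi: "G (snd c p, u, w) = g p (tcoord_inv c p u) (tcoord_inv c p w)" if "p \<in> fst c" for p u w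
    using Gg[OF that, of "tcoord_inv c p u" "tcoord_inv c p w"]
    by (simp add: tcoord_tcoord_inv[OF c(1) that])
  have bil: "bilinear (g p)" and pos: "v \<noteq> 0 \<Longrightarrow> g p v v > 0" for p v
    using g unfolding riemannian_manifold_def by blast+
  have Y: "open ?Y" "?y0 \<in> ?Y" using chart_homeomorphism(2)[OF c(1)] c by auto
  then obtain r1 where r1: "r1 > 0" "cball ?y0 r1 \<subseteq> ?Y"
    using open_contains_cball by blast
  let ?K = "cball ?y0 r1 \<times> sphere (0::'e) 1"
  have K: "compact ?K" by (intro compact_Times compact_cball compact_sphere)
  obtain b :: 'e where "b \<in> Basis" using nonempty_Basis by blast
  then have K0: "?K \<noteq> {}" using r1(1) by (auto intro!: exI[of _ b] simp: norm_Basis)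
  have "continuous_on ?K (\<lambda>z. G (fst z, snd z, snd z))"
    using r1(2) by (intro continuous_on_compose2[OF Ck_on_imp_continuous_on[OF G]] continuous_intros) auto
  then obtain z where z: "z \<in> ?K"
    "\<And>z'. z' \<in> ?K \<Longrightarrow> G (fst z, snd z, snd z) \<le> G (fst z', snd z', snd z')"
    using continuous_attains_inf[OF K K0] by blast
  define l where "l = G (fst z, snd z, snd z)"
  obtain q where q: "q \<in> fst c" "fst z = snd c q" using z(1) r1(2) by auto
  have "snd z \<noteq> 0" using z(1) by auto
  then have "tcoord_inv c q (snd z) \<noteq> 0"
    using tcoord_tcoord_inv[OF c(1) q(1)] tcoord_eq_0_iff[OF c(1) q(1)] by metis
  then have l: "l > 0" unfolding l_def q(2) Gi[OF q(1)] by (rule pos)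
  have lower: "l * (norm (tcoord A c p v))\<^sup>2 \<le> g p v v"
    if p: "p \<in> fst c" "snd c p \<in> ball ?y0 r1" for p v
  proof (cases "v = 0")
    case True
    then show ?thesis
      using linear_0[OF linear_tcoord[OF c(1) p(1)]] bilinear_lzero[OF bil] by simp
  next
    case False
    define u where "u = tcoord A c p v"
    define s where "s = 1 / norm u"
    have u: "norm u > 0" using False tcoord_eq_0_iff[OF c(1) p(1)] by (simp add: u_def)
    have "l \<le> G (snd c p, s *\<^sub>R u, s *\<^sub>R u)"
      unfolding l_def using z(2)[of "(snd c p, s *\<^sub>R u)"] p u by (simp add: s_def)
    also have "s *\<^sub>R u = tcoord A c p (s *\<^sub>R v)"
      by (simp add: u_def linear_cmul[OF linear_tcoord[OF c(1) p(1)]])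
    also have "G (snd c p, tcoord A c p (s *\<^sub>R v), tcoord A c p (s *\<^sub>R v)) = s * s * g p v v"
      unfolding Gg[OF p(1)] by (simp add: bilinear_lmul[OF bil] bilinear_rmul[OF bil])
    finally show ?thesis
      using u by (simp add: s_def u_def[symmetric] power2_eq_square field_simps)
  qed
  have "Ck_on 1 G (?Y \<times> UNIV \<times> UNIV)"
    using Ck_on_Suc_imp[of 1 G] G by (simp only: numeral_2_eq_2 One_nat_def)
  moreover have "open (?Y \<times> (UNIV :: 'e set) \<times> (UNIV :: 'e set))"
    using Y by (intro open_Times) auto
  moreover have "(?y0, 0, 0) \<in> ?Y \<times> (UNIV :: 'e set) \<times> (UNIV :: 'e set)" using Y by simp
  ultimately obtain r2 L where r2: "r2 > 0" "L \<ge> 0"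
    and lip: "\<And>x y. x \<in> ball (?y0, 0, 0) r2 \<Longrightarrow> y \<in> ball (?y0, 0, 0) r2 \<Longrightarrow>
        norm (G x - G y) \<le> L * norm (x - y)"
    by (rule Ck1_locally_Lipschitz) blast
  define \<epsilon> where "\<epsilon> = r2 / 4"
  have \<epsilon>: "\<epsilon> > 0" using r2 by (simp add: \<epsilon>_def)
  have in_ball: "(y, u, w) \<in> ball (?y0, 0, 0) r2"
    if "y \<in> ball ?y0 \<epsilon>" "norm u = \<epsilon>" "norm w = \<epsilon>" for y u w
  proof -
    have "dist (?y0, 0, 0) (y, u, w) = norm (?y0 - y, - u, - w)" by (simp add: dist_norm)
    also have "\<dots> \<le> norm (?y0 - y) + (norm (- u) + norm (- w))"
      by (intro order.trans[OF norm_Pair_le] add_left_mono norm_Pair_le)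
    also have "\<dots> < r2" using that r2 by (simp add: \<epsilon>_def dist_norm)
    finally show ?thesis by simp
  qed
  have lips: "\<bar>g p (tcoord_inv c p u) (tcoord_inv c p w) - g q (tcoord_inv c q u) (tcoord_inv c q w)\<bar>
         \<le> L / (\<epsilon> * \<epsilon>) * norm (snd c p - snd c q) * norm u * norm w"
    if p: "p \<in> fst c" "snd c p \<in> ball ?y0 \<epsilon>" and q: "q \<in> fst c" "snd c q \<in> ball ?y0 \<epsilon>" for p q u w
  proof (cases "u = 0 \<or> w = 0")
    case True
    then show ?thesis
      using linear_0[OF linear_tcoord_inv[OF c(1) p(1)]] linear_0[OF linear_tcoord_inv[OF c(1) q(1)]]
        bilinear_lzero[OF bil] bilinear_rzero[OF bil] by auto
  next
    case False
    define s t where "s = \<epsilon> / norm u" and "t = \<epsilon> / norm w"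
    have st: "s > 0" "t > 0" using False \<epsilon> by (auto simp: s_def t_def)
    have sc: "G (snd c p, s *\<^sub>R u, t *\<^sub>R w) = s * t * g p (tcoord_inv c p u) (tcoord_inv c p w)"
      if "p \<in> fst c" for p
      unfolding Gi[OF that] linear_cmul[OF linear_tcoord_inv[OF c(1) that]]
      by (simp add: bilinear_lmul[OF bil] bilinear_rmul[OF bil])
    have "norm (G (snd c p, s *\<^sub>R u, t *\<^sub>R w) - G (snd c q, s *\<^sub>R u, t *\<^sub>R w))
        \<le> L * norm ((snd c p, s *\<^sub>R u, t *\<^sub>R w) - (snd c q, s *\<^sub>R u, t *\<^sub>R w))"
      using False \<epsilon> p q by (intro lip in_ball) (auto simp: s_def t_def)
    then have "s * t * \<bar>g p (tcoord_inv c p u) (tcoord_inv c p w) - g q (tcoord_inv c q u) (tcoord_inv c q w)\<bar>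
        \<le> L * norm (snd c p - snd c q)"
      unfolding sc[OF p(1)] sc[OF q(1)] using st
      by (simp add: right_diff_distrib[symmetric] abs_mult)
    then have "\<bar>g p (tcoord_inv c p u) (tcoord_inv c p w) - g q (tcoord_inv c q u) (tcoord_inv c q w)\<bar>
        \<le> L * norm (snd c p - snd c q) / (s * t)"
      using st by (simp add: pos_le_divide_eq mult.commute)
    also have "\<dots> = L / (\<epsilon> * \<epsilon>) * norm (snd c p - snd c q) * norm u * norm w"
      using False \<epsilon> by (simp add: s_def t_def)
    finally show ?thesis .
  qed
  show ?thesis
  proof (rule that[of "min r1 \<epsilon>" l "L / (\<epsilon> * \<epsilon>)"])
    show "min r1 \<epsilon> > 0" "l > 0" "L / (\<epsilon> * \<epsilon>) \<ge> 0" using r1 r2 \<epsilon> l by auto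
  qed (use lower lips in auto)
qed

text \<open>The derivative of a retraction is prescribed in the selected chart only; the chain rule carries it
  to every other chart. Openness of the domain of the bundle map is needed to know that \<open>R p v\<close> stays
  in the selected chart for small \<open>v\<close>.\<close>

lemma retraction_has_derivative:
  assumes R: "manifold_retraction A R" and c: "c \<in> A" "p \<in> fst c"
  shows "((\<lambda>v. snd c (R p v)) has_derivative tcoord A c p) (at 0)"
proof -
  let ?d = "chart_at A p"
  note d = chart_at(1)[of p] chart_at(2)[of p]
  have R0: "R p 0 = p" "((\<lambda>v. snd ?d (R p v)) has_derivative (\<lambda>v. v)) (at 0)"
    using R unfolding manifold_retraction_def by blast+
  obtain S where S: "open S"
    "\<And>p v. p \<in> fst ?d \<Longrightarrow> (snd ?d p, tcoord A ?d p v) \<in> S \<longleftrightarrow> R p v \<in> fst ?d"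
    using retraction_in_chart[OF R d(1)] by metis
  have S': "(snd ?d p, v) \<in> S \<longleftrightarrow> R p v \<in> fst ?d" for v
    using S(2)[OF d(2), of v] by (simp add: tcoord_chart_at)
  have "((snd c \<circ> chart_inv ?d) \<circ> (\<lambda>v. snd ?d (R p v)) has_derivative
      (tcoord A c p \<circ> (\<lambda>v. v))) (at 0)"
    unfolding tcoord_eq_trans_deriv using c d R0
    by (intro diff_chain_at has_derivative_trans_deriv) (auto intro: has_derivative_trans_deriv)
  moreover have "open ((\<lambda>v. (snd ?d p, v)) -` S)"
    using S(1) by (intro open_vimage continuous_intros)
  ultimately have "((\<lambda>v. snd c (R p v)) has_derivative (tcoord A c p \<circ> (\<lambda>v. v))) (at 0)"
  proof (rule has_derivative_transform_within_open)
    show "0 \<in> (\<lambda>v. (snd ?d p, v)) -` S" using S' R0 d by simp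
    show "((snd c \<circ> chart_inv ?d) \<circ> (\<lambda>v. snd ?d (R p v))) v = snd c (R p v)"
      if "v \<in> (\<lambda>v. (snd ?d p, v)) -` S" for v
      using that S' chart_inv_chart[OF d(1)] by simp
  qed
  then show ?thesis by (simp add: comp_def)
qed

text \<open>Taylor expansion at the zero vector of each \<open>p\<close> near \<open>p0\<close>, in the direction of the fibre.\<close>

lemma retraction_local_expansion:
  assumes R: "manifold_retraction A R" and c: "c \<in> A" "p0 \<in> fst c"
  obtains r L where "r > 0" "L \<ge> 0"
    "\<And>p v. p \<in> fst c \<Longrightarrow> snd c p \<in> ball (snd c p0) r \<Longrightarrow> norm (tcoord A c p v) < r \<Longrightarrow>
       R p v \<in> fst c \<and>
       norm (snd c (R p v) - snd c p - tcoord A c p v) \<le> L * (norm (tcoord A c p v))\<^sup>2"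
proof -
  let ?y0 = "snd c p0"
  obtain S \<sigma> where S: "open S" and \<sigma>: "Ck_on 2 \<sigma> S"
    and SR: "\<And>p v. p \<in> fst c \<Longrightarrow> (snd c p, tcoord A c p v) \<in> S \<longleftrightarrow> R p v \<in> fst c"
    and \<sigma>R: "\<And>p v. p \<in> fst c \<Longrightarrow> \<sigma> (snd c p, tcoord A c p v) = snd c (R p v)"
    using retraction_in_chart[OF R c(1)] by metis
  have R0: "R p 0 = p" for p using R unfolding manifold_retraction_def by blast
  have tc0: "tcoord A c p 0 = 0" if "p \<in> fst c" for p
    using linear_0[OF linear_tcoord[OF c(1) that]] .
  have S0: "(?y0, 0) \<in> S" using SR[OF c(2), of 0] c(2) by (simp add: R0 tc0)
  obtain r L where r: "r > 0" "L \<ge> 0" "ball (?y0, 0) r \<subseteq> S"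
    and taylor: "\<And>x y. x \<in> ball (?y0, 0) r \<Longrightarrow> y \<in> ball (?y0, 0) r \<Longrightarrow>
        norm (\<sigma> y - \<sigma> x - frechet_derivative \<sigma> (at x) (y - x)) \<le> L * (norm (y - x))\<^sup>2"
    by (rule Ck2_local_Taylor[OF \<sigma> S S0]) blast
  have in_ball: "(y, u) \<in> ball (?y0, 0) r"
    if "y \<in> ball ?y0 (r / 2)" "norm u < r / 2" for y and u :: 'e
  proof -
    have "dist (?y0, 0) (y, u) = norm (?y0 - y, - u)" by (simp add: dist_norm)
    also have "\<dots> \<le> norm (?y0 - y) + norm (- u)" by (rule norm_Pair_le)
    also have "\<dots> < r" using that by (simp add: dist_norm)
    finally show ?thesis by simp
  qed
  show ?thesis
  proof (rule that[of "r / 2" L])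
    fix p v assume p: "p \<in> fst c" "snd c p \<in> ball ?y0 (r / 2)" and v: "norm (tcoord A c p v) < r / 2"
    let ?D = "frechet_derivative \<sigma> (at (snd c p, 0))"
    have b0: "(snd c p, 0 :: 'e) \<in> ball (?y0, 0) r" using r p by (intro in_ball) auto
    have b1: "(snd c p, tcoord A c p v) \<in> ball (?y0, 0) r" using p v by (intro in_ball) auto
    have "\<sigma> differentiable (at (snd c p, 0))"
      using \<sigma> b0 r(3) by (auto simp: numeral_2_eq_2)
    then have D: "(\<sigma> has_derivative ?D) (at (snd c p, tcoord A c p 0))"
      by (simp add: frechet_derivative_works tc0[OF p(1)])
    have "((\<lambda>v. (snd c p, tcoord A c p v)) has_derivative (\<lambda>v. (0, tcoord A c p v))) (at 0)"
      using linear_tcoord[OF c(1) p(1)]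
      by (intro has_derivative_Pair has_derivative_const linear_imp_has_derivative)
    from diff_chain_at[OF this D]
    have "((\<lambda>v. snd c (R p v)) has_derivative (\<lambda>v. ?D (0, tcoord A c p v))) (at 0)"
      by (simp add: comp_def \<sigma>R[OF p(1)])
    then have "(\<lambda>v. ?D (0, tcoord A c p v)) = tcoord A c p"
      using retraction_has_derivative[OF R c(1) p(1)] has_derivative_unique by blast
    then have "?D (0, tcoord A c p v) = tcoord A c p v" by metis
    moreover have "\<sigma> (snd c p, 0) = snd c p"
      using \<sigma>R[OF p(1), of 0] by (simp add: tc0[OF p(1)] R0)
    ultimately have "norm (snd c (R p v) - snd c p - tcoord A c p v) \<le> L * (norm (tcoord A c p v))\<^sup>2"
      using taylor[OF b0 b1] by (simp add: \<sigma>R[OF p(1)] norm_Pair)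
    moreover have "R p v \<in> fst c" using SR[OF p(1)] b1 r(3) by blast
    ultimately show "R p v \<in> fst c \<and>
       norm (snd c (R p v) - snd c p - tcoord A c p v) \<le> L * (norm (tcoord A c p v))\<^sup>2" by blast
  qed (use r in auto)
qed

end

section \<open>Gradients and the tangent norm\<close>

lemma positive_definite_Riesz:
  fixes B :: "'e::euclidean_space \<Rightarrow> 'e \<Rightarrow> real"
  assumes B: "bilinear B" and pos: "\<And>v. v \<noteq> 0 \<Longrightarrow> B v v > 0" and l: "linear l"
  shows "\<exists>!v. \<forall>w. B v w = l w"
proof -
  define F where "F = (\<lambda>v. \<Sum>b\<in>Basis. B v b *\<^sub>R b)"
  have lin: "linear (\<lambda>v. B v w)" "linear (B v)" for v w
    using B by (auto simp: bilinear_def)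
  have F_inner: "F v \<bullet> b = B v b" if "b \<in> Basis" for v b
    using that by (simp add: F_def inner_sum_left inner_Basis if_distrib sum.delta cong: if_cong)
  have linF: "linear F" unfolding F_def
    by (rule linearI) (simp_all add: bilinear_ladd[OF B] bilinear_lmul[OF B] scaleR_left_distrib
        sum.distrib scaleR_sum_right)
  have eq0: "v = 0" if "\<forall>b\<in>Basis. B v b = 0" for v
  proof (rule ccontr)
    assume "v \<noteq> 0"
    moreover have "B v = (\<lambda>_. 0)"
      using that by (intro linear_eq_stdbasis[OF lin(2) linear_zero]) auto
    ultimately show False using pos[of v] by simp
  qed
  have "inj F"
  proof (rule injI)
    fix v w assume "F v = F w"
    then have "B v b = B w b" if "b \<in> Basis" for b using F_inner that by metis
    then have "\<forall>b\<in>Basis. B (v - w) b = 0" by (simp add: bilinear_lsub[OF B])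
    then show "v = w" using eq0 by fastforce
  qed
  then have "surj F" by (simp add: linear_injective_imp_surjective[OF linF])
  then obtain v where v: "F v = (\<Sum>b\<in>Basis. l b *\<^sub>R b)" by (metis surjD)
  have "B v b = l b" if "b \<in> Basis" for b
    using F_inner[OF that, of v] that unfolding v
    by (simp add: inner_sum_left inner_Basis if_distrib sum.delta cong: if_cong)
  then have "B v = l" using linear_eq_stdbasis[OF lin(2) l] by (simp add: fun_eq_iff)
  moreover have "v = v'" if "\<forall>w. B v' w = l w" for v'
  proof -
    have "\<forall>b\<in>Basis. B (v - v') b = 0"
      using that \<open>B v = l\<close> by (simp add: bilinear_lsub[OF B])
    then show ?thesis using eq0 by fastforce
  qed
  ultimately show ?thesis by metis
qed

lemma grad_inner:
  assumes g: "riemannian_manifold A g" and F: "Ck_map_on (Suc k) A id_atlas UNIV F"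
  shows "g p (grad A g F p) w = differential A F p w"
    and grad_unique: "(\<And>w. g p v w = differential A F p w) \<Longrightarrow> v = grad A g F p"
proof -
  have "\<exists>!v. \<forall>w. g p v w = differential A F p w"
    using g linear_differential[OF _ F] unfolding riemannian_manifold_def
    by (intro positive_definite_Riesz) auto
  from theI'[OF this] the1_equality[OF this]
  show "g p (grad A g F p) w = differential A F p w"
    "(\<And>w. g p v w = differential A F p w) \<Longrightarrow> v = grad A g F p"
    unfolding grad_def by blast+
qed

lemma tnorm_sq: "riemannian_manifold A g \<Longrightarrow> (tnorm g p v)\<^sup>2 = g p v v"
  unfolding tnorm_def riemannian_manifold_def
  by (metis bilinear_lzero less_eq_real_def real_sqrt_pow2)

lemma tnorm_nonneg: "riemannian_manifold A g \<Longrightarrow> 0 \<le> tnorm g p v"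
  unfolding tnorm_def riemannian_manifold_def
  by (metis bilinear_lzero less_eq_real_def real_sqrt_ge_zero)

lemma metric_Cauchy_Schwarz:
  assumes g: "riemannian_manifold A g"
  shows "\<bar>g p v w\<bar> \<le> tnorm g p v * tnorm g p w"
proof (cases "w = 0")
  case True
  have "bilinear (g p)" using g unfolding riemannian_manifold_def by blast
  then show ?thesis using True by (simp add: bilinear_rzero tnorm_def)
next
  case False
  have bil: "bilinear (g p)" and sym: "g p w v = g p v w" and pos: "g p w w > 0"
    using g False unfolding riemannian_manifold_def by blast+
  define s where "s = g p v w / g p w w"
  have "0 \<le> (tnorm g p (v - s *\<^sub>R w))\<^sup>2" by simp
  also have "\<dots> = g p v v - 2 * s * g p v w + s * s * g p w w"
    unfolding tnorm_sq[OF g]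
    by (simp add: bilinear_lsub[OF bil] bilinear_rsub[OF bil] bilinear_lmul[OF bil]
        bilinear_rmul[OF bil] sym algebra_simps)
  also have "\<dots> = g p v v - (g p v w)\<^sup>2 / g p w w"
    using pos by (simp add: s_def field_simps power2_eq_square)
  finally have "(g p v w)\<^sup>2 \<le> g p v v * g p w w" using pos by (simp add: pos_divide_le_eq)
  then have "sqrt ((g p v w)\<^sup>2) \<le> sqrt (g p v v * g p w w)" by (rule real_sqrt_le_mono)
  then show ?thesis by (simp add: tnorm_def real_sqrt_mult)
qed

lemma tnorm_triangle:
  assumes g: "riemannian_manifold A g"
  shows "tnorm g p (v + w) \<le> tnorm g p v + tnorm g p w"
proof (rule power2_le_imp_le)
  have bil: "bilinear (g p)" and sym: "g p w v = g p v w"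
    using g unfolding riemannian_manifold_def by blast+
  have "(tnorm g p (v + w))\<^sup>2 = (tnorm g p v)\<^sup>2 + 2 * g p v w + (tnorm g p w)\<^sup>2"
    unfolding tnorm_sq[OF g] by (simp add: bilinear_ladd[OF bil] bilinear_radd[OF bil] sym)
  also have "\<dots> \<le> (tnorm g p v + tnorm g p w)\<^sup>2"
    using metric_Cauchy_Schwarz[OF g, of p v w] by (simp add: power2_sum)
  finally show "(tnorm g p (v + w))\<^sup>2 \<le> (tnorm g p v + tnorm g p w)\<^sup>2" .
qed (simp add: tnorm_nonneg[OF g])

lemma tnorm_scaleR:
  assumes g: "riemannian_manifold A g"
  shows "tnorm g p (s *\<^sub>R v) = \<bar>s\<bar> * tnorm g p v"
proof -
  have bil: "bilinear (g p)" using g unfolding riemannian_manifold_def by blast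
  show ?thesis
    by (simp add: tnorm_def bilinear_lmul[OF bil] bilinear_rmul[OF bil] real_sqrt_mult
        mult.assoc[symmetric])
qed

text \<open>Let \<open>u\<^sub>p\<close> be the gradient at \<open>p\<close> in coordinates and \<open>D\<^sub>p\<close> the derivative of \<open>f\<close> there, so that the
  squared norm is \<open>D\<^sub>p u\<^sub>p\<close>. In
  \<open>D\<^sub>p u\<^sub>p - D\<^sub>q u\<^sub>q = (D\<^sub>p - D\<^sub>q) u\<^sub>p + (D\<^sub>p - D\<^sub>q) u\<^sub>q + (D\<^sub>q u\<^sub>p - D\<^sub>p u\<^sub>q)\<close>
  the last bracket is a difference of the metrics at \<open>q\<close> and \<open>p\<close> on the same pair of vectors. This
  avoids differentiating the inverse of the metric.\<close>

lemma sqnorm_gradient_local_Lipschitz: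
  assumes g: "riemannian_manifold A g" and f: "Ck_map_on 2 A id_atlas UNIV f"
    and c: "c \<in> A" "p0 \<in> fst c"
  obtains r L where "r > 0" "L \<ge> 0"
    "\<And>p. p \<in> fst c \<Longrightarrow> snd c p \<in> ball (snd c p0) r \<Longrightarrow> g p (grad A g f p) (grad A g f p) \<le> L"
    "\<And>p q. p \<in> fst c \<Longrightarrow> snd c p \<in> ball (snd c p0) r \<Longrightarrow>
      q \<in> fst c \<Longrightarrow> snd c q \<in> ball (snd c p0) r \<Longrightarrow>
      \<bar>g p (grad A g f p) (grad A g f p) - g q (grad A g f q) (grad A g f q)\<bar>
        \<le> L * norm (snd c p - snd c q)"
proof -
  have atlas: "smooth_atlas A" and sym: "\<And>p v w. g p v w = g p w v"
    using g unfolding riemannian_manifold_def by blast+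
  note tc = tcoord_inv_tcoord[OF atlas c(1)] tcoord_tcoord_inv[OF atlas c(1)]
  let ?Y = "snd c ` fst c" and ?y0 = "snd c p0" and ?f = "f \<circ> chart_inv c"
  let ?D = "\<lambda>y. frechet_derivative ?f (at y)"
  let ?u = "\<lambda>p. tcoord A c p (grad A g f p)"
  have Y: "open ?Y" "?y0 \<in> ?Y" using chart_homeomorphism(2)[OF atlas c(1)] c by auto
  have f2: "Ck_on 2 ?f ?Y" by (rule Ck_map_on_in_chart[OF atlas f c(1)])
  then have f1: "Ck_on 1 ?f ?Y"
    using Ck_on_Suc_imp[of 1 ?f] by (simp only: numeral_2_eq_2 One_nat_def)
  have D: "(?f has_derivative ?D y) (at y)" if "y \<in> ?Y" for y
    using f1 that unfolding One_nat_def Ck_on.simps frechet_derivative_works[symmetric] by blast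
  obtain r1 l L1 where m: "r1 > 0" "l > 0" "L1 \<ge> 0"
    "\<And>p v. p \<in> fst c \<Longrightarrow> snd c p \<in> ball ?y0 r1 \<Longrightarrow> l * (norm (tcoord A c p v))\<^sup>2 \<le> g p v v"
    "\<And>p q u w. p \<in> fst c \<Longrightarrow> snd c p \<in> ball ?y0 r1 \<Longrightarrow>
       q \<in> fst c \<Longrightarrow> snd c q \<in> ball ?y0 r1 \<Longrightarrow>
       \<bar>g p (tcoord_inv A c p u) (tcoord_inv A c p w) - g q (tcoord_inv A c q u) (tcoord_inv A c q w)\<bar>
         \<le> L1 * norm (snd c p - snd c q) * norm u * norm w"
    by (rule metric_local_bounds[OF atlas g c]) blast
  obtain r2 M where d1: "r2 > 0" "M \<ge> 0"
    "\<And>y v. y \<in> ball ?y0 r2 \<Longrightarrow> norm (?D y v) \<le> M * norm v"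
    by (rule Ck1_locally_Lipschitz[OF f1 Y]) blast
  obtain r3 L3 where d2: "r3 > 0" "L3 \<ge> 0"
    "\<And>x y v. x \<in> ball ?y0 r3 \<Longrightarrow> y \<in> ball ?y0 r3 \<Longrightarrow>
       norm (?D y v - ?D x v) \<le> L3 * norm (y - x) * norm v"
    by (rule Ck2_local_Taylor[OF f2 Y]) blast
  define r where "r = Min {r1, r2, r3}"
  define B where "B = M / l"
  define L where "L = M * B + (2 * L3 * B + L1 * B * B)"
  have r: "r > 0" "r \<le> r1" "r \<le> r2" "r \<le> r3" using m(1) d1(1) d2(1) by (auto simp: r_def)
  have B: "B \<ge> 0" using m d1 by (simp add: B_def)
  have L: "L \<ge> 0" "M * B \<le> L" "2 * L3 * B + L1 * B * B \<le> L" using m d1 d2 B by (auto simp: L_def)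
  have inner: "g p (grad A g f p) v = ?D (snd c p) (tcoord A c p v)" if p: "p \<in> fst c" for p v
  proof -
    have "g p (grad A g f p) v = differential A f p v"
      using grad_inner(1)[OF g, of 1 f] f by (simp only: numeral_2_eq_2 One_nat_def)
    also have "\<dots> = ?D (snd c p) (tcoord A c p v)"
      by (rule differential_in_chart[OF atlas c(1) p D]) (use p in blast)
    finally show ?thesis .
  qed
  have u: "norm (?u p) \<le> B" if p: "p \<in> fst c" "snd c p \<in> ball ?y0 r" for p
  proof (cases "?u p = 0")
    case False
    have "l * (norm (?u p))\<^sup>2 \<le> g p (grad A g f p) (grad A g f p)" using m(4) p r by auto
    also have "\<dots> \<le> M * norm (?u p)"
      unfolding inner[OF p(1)] using d1(3)[of "snd c p" "?u p"] p r by auto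
    finally have "(l * norm (?u p)) * norm (?u p) \<le> M * norm (?u p)"
      by (simp add: power2_eq_square mult.assoc)
    then have "l * norm (?u p) \<le> M" using False by simp
    then show ?thesis using m(2) by (simp add: B_def pos_le_divide_eq mult.commute)
  qed (use B in simp)
  show ?thesis
  proof (rule that[OF r(1) L(1)])
    fix p assume p: "p \<in> fst c" "snd c p \<in> ball ?y0 r"
    have "g p (grad A g f p) (grad A g f p) \<le> M * norm (?u p)"
      unfolding inner[OF p(1)] using d1(3)[of "snd c p" "?u p"] p r by auto
    also have "\<dots> \<le> M * B" using u[OF p] d1(2) by (rule mult_left_mono)
    finally show "g p (grad A g f p) (grad A g f p) \<le> L" using L by simp
  next
    fix p q assume p: "p \<in> fst c" "snd c p \<in> ball ?y0 r" and q: "q \<in> fst c" "snd c q \<in> ball ?y0 r"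
    let ?d = "norm (snd c p - snd c q)"
    have D_diff: "\<bar>?D (snd c p) v - ?D (snd c q) v\<bar> \<le> L3 * ?d * B" if "norm v \<le> B" for v
    proof -
      have "\<bar>?D (snd c p) v - ?D (snd c q) v\<bar> \<le> L3 * ?d * norm v"
        using d2(3)[of "snd c q" "snd c p" v] p q r by auto
      also have "\<dots> \<le> L3 * ?d * B" using that d2(2) by (intro mult_left_mono) auto
      finally show ?thesis .
    qed
    (* the cross terms D p (u q) and D q (u p) are the same pairing of the two gradients,
       once in the metric at p and once in the metric at q *)
    have pq: "?D (snd c p) (?u q) = g p (tcoord_inv A c p (?u p)) (tcoord_inv A c p (?u q))"
      using inner[OF p(1), of "tcoord_inv A c p (?u q)"] p(1) by (simp add: tc)
    have qp: "?D (snd c q) (?u p) = g q (tcoord_inv A c q (?u p)) (tcoord_inv A c q (?u q))"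
      using inner[OF q(1), of "tcoord_inv A c q (?u p)"] q(1) sym by (simp add: tc)
    have "\<bar>?D (snd c p) (?u q) - ?D (snd c q) (?u p)\<bar> \<le> L1 * ?d * norm (?u p) * norm (?u q)"
      unfolding pq qp using p q r by (intro m(5)) auto
    also have "\<dots> \<le> L1 * ?d * B * B"
      using u[OF p] u[OF q] m(3) B by (intro mult_mono) auto
    finally have "\<bar>?D (snd c p) (?u q) - ?D (snd c q) (?u p)\<bar> \<le> L1 * ?d * B * B" .
    moreover note D_diff[OF u[OF p]] D_diff[OF u[OF q]]
    ultimately have "\<bar>?D (snd c p) (?u p) - ?D (snd c q) (?u q)\<bar>
        \<le> L3 * ?d * B + L3 * ?d * B + L1 * ?d * B * B" by linarith
    also have "\<dots> = (2 * L3 * B + L1 * B * B) * ?d" by (simp add: algebra_simps)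
    also have "\<dots> \<le> L * ?d" using L by (intro mult_right_mono) auto
    finally show "\<bar>g p (grad A g f p) (grad A g f p) - g q (grad A g f q) (grad A g f q)\<bar> \<le> L * ?d"
      unfolding inner[OF p(1)] inner[OF q(1)] .
  qed
qed

section \<open>Descent along the retraction\<close>

text \<open>In a chart, \<open>R p v\<close> is \<open>p + v\<close> up to an error quadratic in \<open>v\<close>, and \<open>f\<close> is affine up to a
  quadratic error; ellipticity converts Euclidean lengths into lengths in the metric.\<close>

lemma descent_local:
  assumes g: "riemannian_manifold A g" and R: "manifold_retraction A R"
    and f: "Ck_map_on 2 A id_atlas UNIV f"
  obtains U \<delta> L where "open U" "p0 \<in> U" "\<delta> > 0" "L \<ge> 0"
    "\<And>p. p \<in> U \<Longrightarrow> \<bar>f p\<bar> \<le> L"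
    "\<And>p. p \<in> U \<Longrightarrow> g p (grad A g f p) (grad A g f p) \<le> L"
    "\<And>p v. p \<in> U \<Longrightarrow> tnorm g p v < \<delta> \<Longrightarrow>
       f (R p v) \<le> f p + g p (grad A g f p) v + L * (tnorm g p v)\<^sup>2"
    "\<And>p v. p \<in> U \<Longrightarrow> tnorm g p v < \<delta> \<Longrightarrow>
       \<bar>g (R p v) (grad A g f (R p v)) (grad A g f (R p v)) - g p (grad A g f p) (grad A g f p)\<bar>
         \<le> L * tnorm g p v"
proof -
  have atlas: "smooth_atlas A" using g unfolding riemannian_manifold_def by blast
  define c where "c = chart_at A p0"
  have c: "c \<in> A" "p0 \<in> fst c" using chart_at[OF atlas] by (auto simp: c_def)
  let ?Y = "snd c ` fst c" and ?y0 = "snd c p0" and ?f = "f \<circ> chart_inv c"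
  let ?D = "\<lambda>y. frechet_derivative ?f (at y)"
  let ?N = "\<lambda>p. g p (grad A g f p) (grad A g f p)"
  have Y: "open ?Y" "?y0 \<in> ?Y" using chart_homeomorphism(2)[OF atlas c(1)] c by auto
  have f2: "Ck_on 2 ?f ?Y" by (rule Ck_map_on_in_chart[OF atlas f c(1)])
  then have f1: "Ck_on 1 ?f ?Y"
    using Ck_on_Suc_imp[of 1 ?f] by (simp only: numeral_2_eq_2 One_nat_def)
  have D: "(?f has_derivative ?D y) (at y)" if "y \<in> ?Y" for y
    using f1 that unfolding One_nat_def Ck_on.simps frechet_derivative_works[symmetric] by blast
  have fc: "?f (snd c p) = f p" if "p \<in> fst c" for p
    using chart_inv_chart[OF atlas c(1) that] by simp
  obtain r1 l where m: "r1 > 0" "l > 0"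
    "\<And>p v. p \<in> fst c \<Longrightarrow> snd c p \<in> ball ?y0 r1 \<Longrightarrow> l * (norm (tcoord A c p v))\<^sup>2 \<le> g p v v"
    by (rule metric_local_bounds[OF atlas g c]) blast
  obtain r2 M where d1: "r2 > 0" "M \<ge> 0"
    "\<And>y v. y \<in> ball ?y0 r2 \<Longrightarrow> norm (?D y v) \<le> M * norm v"
    "\<And>x y. x \<in> ball ?y0 r2 \<Longrightarrow> y \<in> ball ?y0 r2 \<Longrightarrow> norm (?f x - ?f y) \<le> M * norm (x - y)"
    by (rule Ck1_locally_Lipschitz[OF f1 Y]) blast
  obtain r3 L3 where d2: "r3 > 0" "L3 \<ge> 0"
    "\<And>x y. x \<in> ball ?y0 r3 \<Longrightarrow> y \<in> ball ?y0 r3 \<Longrightarrow>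
       norm (?f y - ?f x - ?D x (y - x)) \<le> L3 * (norm (y - x))\<^sup>2"
    by (rule Ck2_local_Taylor[OF f2 Y]) blast
  obtain r4 L4 where re: "r4 > 0" "L4 \<ge> 0"
    "\<And>p v. p \<in> fst c \<Longrightarrow> snd c p \<in> ball ?y0 r4 \<Longrightarrow> norm (tcoord A c p v) < r4 \<Longrightarrow>
       R p v \<in> fst c \<and>
       norm (snd c (R p v) - snd c p - tcoord A c p v) \<le> L4 * (norm (tcoord A c p v))\<^sup>2"
    by (rule retraction_local_expansion[OF atlas R c]) blast
  obtain r5 L5 where N: "r5 > 0" "L5 \<ge> 0"
    "\<And>p. p \<in> fst c \<Longrightarrow> snd c p \<in> ball ?y0 r5 \<Longrightarrow> ?N p \<le> L5"
    "\<And>p q. p \<in> fst c \<Longrightarrow> snd c p \<in> ball ?y0 r5 \<Longrightarrow> q \<in> fst c \<Longrightarrow> snd c q \<in> ball ?y0 r5 \<Longrightarrow>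
      \<bar>?N p - ?N q\<bar> \<le> L5 * norm (snd c p - snd c q)"
    by (rule sqnorm_gradient_local_Lipschitz[OF g f c]) blast
  define r where "r = Min {r1, r2, r3, r4, r5}"
  have r: "r > 0" "r \<le> r1" "r \<le> r2" "r \<le> r3" "r \<le> r4" "r \<le> r5"
    using m(1) d1(1) d2(1) re(1) N(1) by (auto simp: r_def)
  define Q where "Q = 1 + L4 * r"
  define \<epsilon> where "\<epsilon> = r / (2 * Q)"
  have Q: "Q \<ge> 1" using re r by (simp add: Q_def)
  have \<epsilon>: "\<epsilon> > 0" "\<epsilon> \<le> r" "Q * \<epsilon> \<le> r / 2"
  proof -
    show "\<epsilon> > 0" "Q * \<epsilon> \<le> r / 2" using Q r by (auto simp: \<epsilon>_def)
    have "r * 1 \<le> r * (2 * Q)" using Q r by (intro mult_left_mono) auto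
    then show "\<epsilon> \<le> r" using Q by (simp add: \<epsilon>_def field_simps)
  qed
  define C1 where "C1 = (L3 * Q\<^sup>2 + M * L4) / l"
  define C2 where "C2 = L5 * Q / sqrt l"
  define L where "L = Max {\<bar>f p0\<bar> + M * r, L5, C1, C2}"
  have L: "\<bar>f p0\<bar> + M * r \<le> L" "L5 \<le> L" "C1 \<le> L" "C2 \<le> L" unfolding L_def by auto
  have L0: "L \<ge> 0" using L N by linarith
  define U where "U = fst c \<inter> snd c -` ball ?y0 (r / 2)"
  have U: "p \<in> fst c" "snd c p \<in> ball ?y0 (r / 2)" "snd c p \<in> ball ?y0 r" if "p \<in> U" for p
    using that r by (auto simp: U_def)
  have coords: "norm (tcoord A c p v) \<le> tnorm g p v / sqrt l" if "p \<in> U" for p v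
  proof -
    have "l * (norm (tcoord A c p v))\<^sup>2 \<le> g p v v" using m(3) U[OF that] r by auto
    then have "sqrt (l * (norm (tcoord A c p v))\<^sup>2) \<le> tnorm g p v" by (simp add: tnorm_def)
    then show ?thesis using m(2) by (simp add: real_sqrt_mult pos_le_divide_eq mult.commute)
  qed
  have step: "R p v \<in> fst c \<and> snd c (R p v) \<in> ball ?y0 r \<and>
      norm (snd c (R p v) - snd c p) \<le> Q * norm (tcoord A c p v) \<and>
      norm (snd c (R p v) - snd c p - tcoord A c p v) \<le> L4 * (norm (tcoord A c p v))\<^sup>2"
    if p: "p \<in> U" and v: "tnorm g p v < \<epsilon> * sqrt l" for p v
  proof -
    let ?u = "tcoord A c p v"
    have "tnorm g p v / sqrt l < \<epsilon>" using v m(2) by (simp add: pos_divide_less_eq)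
    then have u: "norm ?u < \<epsilon>" using coords[OF p, of v] by simp
    have *: "R p v \<in> fst c" "norm (snd c (R p v) - snd c p - ?u) \<le> L4 * (norm ?u)\<^sup>2"
      using re(3)[OF U(1)[OF p], of v] U[OF p] u \<epsilon> r by auto
    have "norm (snd c (R p v) - snd c p) \<le> norm (snd c (R p v) - snd c p - ?u) + norm ?u"
      by (metis diff_add_cancel norm_triangle_ineq)
    also have "\<dots> \<le> L4 * (norm ?u)\<^sup>2 + norm ?u" using * by simp
    also have "L4 * (norm ?u)\<^sup>2 \<le> L4 * (r * norm ?u)"
      unfolding power2_eq_square using u \<epsilon> re(2) by (intro mult_left_mono mult_right_mono) auto
    finally have Qu: "norm (snd c (R p v) - snd c p) \<le> Q * norm ?u" by (simp add: Q_def algebra_simps)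
    have "Q * norm ?u \<le> Q * \<epsilon>" using u Q by (intro mult_left_mono) auto
    then have "dist (snd c p) (snd c (R p v)) \<le> r / 2"
      using Qu \<epsilon>(3) by (simp add: dist_norm norm_minus_commute)
    then have "dist ?y0 (snd c (R p v)) < r"
      using U(2)[OF p] dist_triangle[of ?y0 "snd c (R p v)" "snd c p"] by simp
    then show ?thesis using * Qu by simp
  qed
  show ?thesis
  proof (rule that[of U "\<epsilon> * sqrt l" L])
    show "open U" unfolding U_def by (rule open_chart_preimage[OF atlas c(1) open_ball])
    show "p0 \<in> U" using c r by (simp add: U_def)
    show "\<epsilon> * sqrt l > 0" "L \<ge> 0" using \<epsilon> m L0 by auto
  next
    fix p assume p: "p \<in> U"
    have "\<bar>f p - f p0\<bar> \<le> M * norm (snd c p - ?y0)"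
      using d1(4)[of "snd c p" ?y0] U[OF p] r fc[OF U(1)[OF p]] fc[OF c(2)] by auto
    also have "\<dots> \<le> M * r"
      using U(3)[OF p] d1(2) by (intro mult_left_mono) (auto simp: dist_norm norm_minus_commute)
    finally show "\<bar>f p\<bar> \<le> L" using L by linarith
    show "?N p \<le> L" using N(3)[OF U(1)[OF p]] U[OF p] r L by force
  next
    fix p v assume p: "p \<in> U" and v: "tnorm g p v < \<epsilon> * sqrt l"
    let ?u = "tcoord A c p v" and ?y = "snd c p" and ?z = "snd c (R p v)"
    note st = step[OF p v]
    have lin: "linear (?D ?y)" using D[of ?y] U(1)[OF p] has_derivative_linear by blast
    have gu: "g p (grad A g f p) v = ?D ?y ?u"
    proof -
      have "g p (grad A g f p) v = differential A f p v"
        using grad_inner(1)[OF g, of 1 f] f by (simp only: numeral_2_eq_2 One_nat_def)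
      also have "\<dots> = ?D ?y ?u"
        by (rule differential_in_chart[OF atlas c(1) U(1)[OF p] D]) (use U(1)[OF p] in blast)
      finally show ?thesis .
    qed
    have "norm (?f ?z - ?f ?y - ?D ?y (?z - ?y)) \<le> L3 * (norm (?z - ?y))\<^sup>2"
      using st U[OF p] r by (intro d2(3)) auto
    also have "\<dots> \<le> L3 * (Q * norm ?u)\<^sup>2"
      using st d2(2) by (intro mult_left_mono power_mono) auto
    finally have 1: "\<bar>?f ?z - ?f ?y - ?D ?y (?z - ?y)\<bar> \<le> L3 * Q\<^sup>2 * (norm ?u)\<^sup>2"
      by (simp add: power_mult_distrib mult.assoc)
    have "\<bar>?D ?y (?z - ?y - ?u)\<bar> \<le> M * norm (?z - ?y - ?u)"
      using d1(3)[of ?y "?z - ?y - ?u"] U[OF p] r by auto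
    also have "\<dots> \<le> M * (L4 * (norm ?u)\<^sup>2)" using st d1(2) by (intro mult_left_mono) auto
    finally have 2: "\<bar>?D ?y (?z - ?y) - ?D ?y ?u\<bar> \<le> M * L4 * (norm ?u)\<^sup>2"
      by (simp add: linear_diff[OF lin] mult.assoc)
    have "f (R p v) \<le> f p + ?D ?y ?u + (L3 * Q\<^sup>2 + M * L4) * (norm ?u)\<^sup>2"
      using 1 2 fc[OF U(1)[OF p]] fc[of "R p v"] st by (simp add: distrib_right)
    moreover have "(L3 * Q\<^sup>2 + M * L4) * (norm ?u)\<^sup>2 \<le> (L3 * Q\<^sup>2 + M * L4) * (tnorm g p v / sqrt l)\<^sup>2"
      using coords[OF p, of v] d1(2) d2(2) re(2) by (intro mult_left_mono power_mono) auto
    moreover have "(L3 * Q\<^sup>2 + M * L4) * (tnorm g p v / sqrt l)\<^sup>2 = C1 * (tnorm g p v)\<^sup>2"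
      using m(2) by (simp add: C1_def power_divide)
    moreover have "C1 * (tnorm g p v)\<^sup>2 \<le> L * (tnorm g p v)\<^sup>2"
      using L by (intro mult_right_mono) auto
    ultimately show "f (R p v) \<le> f p + g p (grad A g f p) v + L * (tnorm g p v)\<^sup>2"
      unfolding gu by linarith
    have "\<bar>?N (R p v) - ?N p\<bar> \<le> L5 * norm (?z - ?y)"
      using st U[OF p] r by (intro N(4)) auto
    also have "\<dots> \<le> L5 * (Q * (tnorm g p v / sqrt l))"
      using st N(2) coords[OF p, of v] Q
      by (intro mult_left_mono order.trans[OF _ mult_left_mono[OF coords[OF p]]]) auto
    also have "\<dots> = C2 * tnorm g p v" by (simp add: C2_def)
    also have "\<dots> \<le> L * tnorm g p v"
      using L tnorm_nonneg[OF g] by (intro mult_right_mono) auto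
    finally show "\<bar>?N (R p v) - ?N p\<bar> \<le> L * tnorm g p v" .
  qed
qed

text \<open>For short steps the local constants are combined over a finite cover. Requiring \<open>R p v\<close> to lie
  in the compact set extends the estimates to steps of any length: the function and its gradient
  are bounded there, and a bounded term is at most a multiple of the length of a long step, or of its
  square.\<close>

lemma descent_on_compact:
  assumes g: "riemannian_manifold A g" and R: "manifold_retraction A R"
    and f: "Ck_map_on 2 A id_atlas UNIV f" and \<Omega>: "compact \<Omega>"
  obtains L where "L \<ge> 0"
    "\<And>p. p \<in> \<Omega> \<Longrightarrow> tnorm g p (grad A g f p) \<le> L"
    "\<And>p v. p \<in> \<Omega> \<Longrightarrow> R p v \<in> \<Omega> \<Longrightarrow>
       f (R p v) \<le> f p + g p (grad A g f p) v + L * (tnorm g p v)\<^sup>2"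
    "\<And>p v. p \<in> \<Omega> \<Longrightarrow> R p v \<in> \<Omega> \<Longrightarrow>
       \<bar>(tnorm g (R p v) (grad A g f (R p v)))\<^sup>2 - (tnorm g p (grad A g f p))\<^sup>2\<bar> \<le> L * tnorm g p v"
proof -
  let ?N = "\<lambda>p. g p (grad A g f p) (grad A g f p)"
  define good where "good = (\<lambda>U \<delta> L. open U \<and> \<delta> > 0 \<and> L \<ge> 0 \<and> (\<forall>p\<in>U. \<bar>f p\<bar> \<le> L \<and> ?N p \<le> L \<and>
     (\<forall>v. tnorm g p v < \<delta> \<longrightarrow> f (R p v) \<le> f p + g p (grad A g f p) v + L * (tnorm g p v)\<^sup>2 \<and>
       \<bar>?N (R p v) - ?N p\<bar> \<le> L * tnorm g p v)))"
  have "\<exists>U \<delta> L. p0 \<in> U \<and> good U \<delta> L" for p0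
  proof -
    obtain U \<delta> L where "open U" "p0 \<in> U" "\<delta> > 0" "L \<ge> 0"
      "\<And>p. p \<in> U \<Longrightarrow> \<bar>f p\<bar> \<le> L"
      "\<And>p. p \<in> U \<Longrightarrow> ?N p \<le> L"
      "\<And>p v. p \<in> U \<Longrightarrow> tnorm g p v < \<delta> \<Longrightarrow>
         f (R p v) \<le> f p + g p (grad A g f p) v + L * (tnorm g p v)\<^sup>2"
      "\<And>p v. p \<in> U \<Longrightarrow> tnorm g p v < \<delta> \<Longrightarrow> \<bar>?N (R p v) - ?N p\<bar> \<le> L * tnorm g p v"
      by (rule descent_local[OF g R f, of p0]) blast
    then have "p0 \<in> U \<and> good U \<delta> L" unfolding good_def by simp
    then show ?thesis by blast
  qed
  then obtain U \<delta> L where UdL: "\<And>p. p \<in> U p \<and> good (U p) (\<delta> p) (L p)" by metis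
  obtain D where D: "D \<subseteq> \<Omega>" "finite D" "\<Omega> \<subseteq> (\<Union>p\<in>D. U p)"
  proof (rule compactE_image[OF \<Omega>, of \<Omega> U])
    show "open (U p)" for p using UdL[of p] unfolding good_def by blast
    show "\<Omega> \<subseteq> (\<Union>p\<in>\<Omega>. U p)" using UdL by blast
  qed blast
  define d where "d = Min (insert 1 (\<delta> ` D))"
  define K where "K = sum L D"
  have pos: "\<delta> p > 0" "L p \<ge> 0" for p using UdL[of p] unfolding good_def by auto
  have d: "d > 0" "\<And>p. p \<in> D \<Longrightarrow> d \<le> \<delta> p" unfolding d_def using D(2) pos by auto
  have K: "K \<ge> 0" "\<And>p. p \<in> D \<Longrightarrow> L p \<le> K"
    unfolding K_def using D(2) pos by (auto intro: sum_nonneg member_le_sum)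
  have nn: "tnorm g p v \<ge> 0" "g p v v \<ge> 0" for p v
    using tnorm_sq[OF g, of p v] zero_le_power2[of "tnorm g p v"] by (auto simp: tnorm_def)
  have loc: "\<bar>f p\<bar> \<le> K \<and> ?N p \<le> K \<and>
     (tnorm g p v < d \<longrightarrow> f (R p v) \<le> f p + g p (grad A g f p) v + K * (tnorm g p v)\<^sup>2 \<and>
       \<bar>?N (R p v) - ?N p\<bar> \<le> K * tnorm g p v)" if p: "p \<in> \<Omega>" for p v
  proof -
    obtain q where q: "q \<in> D" "p \<in> U q" using p D(3) by blast
    then have "\<bar>f p\<bar> \<le> L q \<and> ?N p \<le> L q \<and>
     (tnorm g p v < \<delta> q \<longrightarrow> f (R p v) \<le> f p + g p (grad A g f p) v + L q * (tnorm g p v)\<^sup>2 \<and>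
       \<bar>?N (R p v) - ?N p\<bar> \<le> L q * tnorm g p v)"
      using UdL[of q] unfolding good_def by blast
    moreover have "L q * (tnorm g p v)\<^sup>2 \<le> K * (tnorm g p v)\<^sup>2" "L q * tnorm g p v \<le> K * tnorm g p v"
      using K(2)[OF q(1)] nn by (auto intro: mult_right_mono)
    ultimately show ?thesis using K(2)[OF q(1)] d(2)[OF q(1)] by (smt (verit))
  qed
  (* the terms with a power of d absorb the steps of length at least d, where |v|/d is at least 1 *)
  define S where "S = sqrt K"
  define L' where "L' = K + S + (2 * K / d\<^sup>2 + S / d) + 2 * K / d"
  have S: "S \<ge> 0" using K by (simp add: S_def)
  have L': "L' \<ge> 0" "K \<le> L'" "S \<le> L'" "2 * K / d\<^sup>2 + S / d \<le> L'" "2 * K / d \<le> L'"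
    using K(1) S d(1) by (simp_all add: L'_def add_nonneg_nonneg)
  have gradS: "tnorm g p (grad A g f p) \<le> S" if "p \<in> \<Omega>" for p
    unfolding S_def tnorm_def using loc[OF that] by simp
  show ?thesis
  proof (rule that[OF L'(1)])
    show "tnorm g p (grad A g f p) \<le> L'" if "p \<in> \<Omega>" for p using gradS[OF that] L' by linarith
  next
    fix p v assume p: "p \<in> \<Omega>" "R p v \<in> \<Omega>"
    let ?v = "tnorm g p v"
    show "f (R p v) \<le> f p + g p (grad A g f p) v + L' * ?v\<^sup>2"
    proof (cases "?v < d")
      case True
      have "K * ?v\<^sup>2 \<le> L' * ?v\<^sup>2" using L' by (intro mult_right_mono) auto
      then show ?thesis using loc[OF p(1), of v] True by linarith
    next
      case False
      then have vd: "?v / d \<ge> 1" using d(1) by simp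
      have CS: "\<bar>g p (grad A g f p) v\<bar> \<le> S * ?v"
        using metric_Cauchy_Schwarz[OF g, of p "grad A g f p" v]
          mult_right_mono[OF gradS[OF p(1)] nn(1)[of p v]] by linarith
      have "2 * K * 1 \<le> 2 * K * (?v / d)\<^sup>2"
        using vd K by (intro mult_left_mono one_le_power) auto
      moreover have "S * ?v * 1 \<le> S * ?v * (?v / d)"
        using vd S nn by (intro mult_left_mono) auto
      ultimately have "2 * K + S * ?v \<le> (2 * K / d\<^sup>2 + S / d) * ?v\<^sup>2"
        by (simp add: power2_eq_square field_simps)
      also have "\<dots> \<le> L' * ?v\<^sup>2" using L' by (intro mult_right_mono) auto
      finally show ?thesis using CS loc[OF p(1), of v] loc[OF p(2), of v] by linarith
    qed
    show "\<bar>(tnorm g (R p v) (grad A g f (R p v)))\<^sup>2 - (tnorm g p (grad A g f p))\<^sup>2\<bar> \<le> L' * ?v"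
    proof (cases "?v < d")
      case True
      have "K * ?v \<le> L' * ?v" using L' nn by (intro mult_right_mono) auto
      then show ?thesis using loc[OF p(1), of v] True unfolding tnorm_sq[OF g] by linarith
    next
      case False
      have "2 * K * 1 \<le> 2 * K * (?v / d)" using False d K by (intro mult_left_mono) auto
      also have "\<dots> \<le> L' * ?v"
        using mult_right_mono[OF L'(5) nn(1)[of p v]] by simp
      finally have "2 * K \<le> L' * ?v" by simp
      then show ?thesis
        using loc[OF p(1), of v] loc[OF p(2), of v] nn(2)[of p "grad A g f p"]
          nn(2)[of "R p v" "grad A g f (R p v)"] unfolding tnorm_sq[OF g] by linarith
    qed
  qed
qed

section \<open>Series of innovations driven by independent uniform choices\<close>

text \<open>The choice \<open>J i\<close> is made at time \<open>\<tau> i\<close>, and there may be times without a choice.\<close>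

locale uniform_choices = prob_space M for M :: "'w measure" +
  fixes J :: "'i \<Rightarrow> 'w \<Rightarrow> 'b" and K :: "'i set" and \<tau> :: "'i \<Rightarrow> nat" and \<B> :: "'b set"
  assumes finite_choices: "finite \<B>"
    and indep_choices: "indep_vars (\<lambda>_. count_space \<B>) J K"
    and choice_uniform: "i \<in> K \<Longrightarrow> distr M (count_space \<B>) (J i) = uniform_count_measure \<B>"
    and inj_time: "inj_on \<tau> K"
begin

definition past :: "nat \<Rightarrow> 'i set" where
  "past k = {i \<in> K. \<tau> i < k}"

text \<open>Being a function of the past choices replaces measurability with respect to a filtration.\<close>

definition adapted :: "nat \<Rightarrow> ('w \<Rightarrow> 'c) \<Rightarrow> bool" where
  "adapted k G \<longleftrightarrow> (\<forall>x\<in>space M. \<forall>y\<in>space M. (\<forall>i\<in>past k. J i x = J i y) \<longrightarrow> G x = G y)"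

text \<open>A martingale difference: the second condition says that the conditional expectation given the
  past vanishes.\<close>

definition innovation :: "nat \<Rightarrow> ('w \<Rightarrow> real) \<Rightarrow> bool" where
  "innovation k \<xi> \<longleftrightarrow> adapted (Suc k) \<xi> \<and>
     (\<forall>G. adapted k G \<longrightarrow> expectation (\<lambda>x. G x * \<xi> x) = 0)"

lemma in_past: "i \<in> K \<Longrightarrow> \<tau> i < k \<Longrightarrow> i \<in> past k" by (simp add: past_def)

lemma past_subset: "past k \<subseteq> K" by (auto simp: past_def)

lemma finite_past: "finite (past k)"
proof (rule finite_imageD)
  show "finite (\<tau> ` past k)" by (rule finite_subset[of _ "{..<k}"]) (auto simp: past_def)
  show "inj_on \<tau> (past k)" using inj_time past_subset by (rule inj_on_subset)
qed

lemma past_mono: "j \<le> k \<Longrightarrow> past j \<subseteq> past k" by (auto simp: past_def)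

lemma adapted_mono: "adapted j G \<Longrightarrow> j \<le> k \<Longrightarrow> adapted k G"
  using past_mono unfolding adapted_def by (meson subsetD)

lemma adapted_const: "adapted k (\<lambda>_. c)"
  by (simp add: adapted_def)

lemma adapted_comp2:
  "adapted k F \<Longrightarrow> adapted k G \<Longrightarrow> adapted k (\<lambda>x. h (F x) (G x))"
  unfolding adapted_def by metis

lemma adapted_comp: "adapted k F \<Longrightarrow> adapted k (\<lambda>x. h (F x))"
  unfolding adapted_def by metis

lemma adapted_sum:
  "(\<And>j. j \<in> A \<Longrightarrow> adapted k (F j)) \<Longrightarrow> adapted k (\<lambda>x. \<Sum>j\<in>A. F j x)"
  unfolding adapted_def by (intro ballI impI sum.cong refl) blast

lemma choices_measurable: "i \<in> K \<Longrightarrow> J i \<in> measurable M (count_space \<B>)"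
  using indep_choices unfolding indep_vars_def2 by blast

lemma adapted_factor:
  assumes "adapted k G"
  obtains G' where "\<And>x. x \<in> space M \<Longrightarrow> G x = G' (restrict (\<lambda>i. J i x) (past k))"
proof (rule that)
  fix x assume x: "x \<in> space M"
  let ?r = "\<lambda>x. restrict (\<lambda>i. J i x) (past k)"
  define y where "y = (SOME y. y \<in> space M \<and> ?r y = ?r x)"
  have "y \<in> space M \<and> ?r y = ?r x"
    unfolding y_def by (rule someI[of _ x]) (use x in simp)
  then have "y \<in> space M" "\<forall>i\<in>past k. J i x = J i y"
    by (auto simp: fun_eq_iff restrict_def split: if_splits)
  then have "G x = G y" using assms x unfolding adapted_def by blast
  then show "G x = (\<lambda>u. G (SOME y. y \<in> space M \<and> ?r y = u)) (?r x)" by (simp add: y_def)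
qed

lemma PiM_past: "PiM (past k) (\<lambda>_. count_space \<B>) = count_space (PiE (past k) (\<lambda>_. \<B>))"
  using count_space_PiM_finite[OF finite_past, of "\<lambda>_. \<B>" k] finite_choices
  by (simp add: countable_finite)

lemma restrict_past_measurable:
  "(\<lambda>x. restrict (\<lambda>i. J i x) (past k)) \<in> measurable M (PiM (past k) (\<lambda>_. count_space \<B>))"
  using choices_measurable past_subset by (intro measurable_restrict) auto

lemma adapted_bounded_measurable:
  fixes G :: "'w \<Rightarrow> real"
  assumes "adapted k G"
  shows "G \<in> borel_measurable M" and "\<exists>C. \<forall>x\<in>space M. \<bar>G x\<bar> \<le> C"
proof -
  let ?r = "\<lambda>x. restrict (\<lambda>i. J i x) (past k)"
  obtain G' where G': "\<And>x. x \<in> space M \<Longrightarrow> G x = G' (?r x)"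
    using adapted_factor[OF assms] by blast
  have "G' \<in> borel_measurable (PiM (past k) (\<lambda>_. count_space \<B>))" by (simp add: PiM_past)
  from measurable_compose[OF restrict_past_measurable this]
  show "G \<in> borel_measurable M" using measurable_cong[of M G "\<lambda>x. G' (?r x)"] G' by auto
  let ?P = "PiE (past k) (\<lambda>_. \<B>)"
  have "finite ?P" using finite_past finite_choices by (intro finite_PiE) auto
  then have fin: "finite ((\<lambda>u. \<bar>G' u\<bar>) ` ?P)" by simp
  have "\<bar>G x\<bar> \<le> Max ((\<lambda>u. \<bar>G' u\<bar>) ` ?P)" if "x \<in> space M" for x
  proof -
    have "?r x \<in> ?P"
      using measurable_space[OF restrict_past_measurable[of k] that] by (simp add: PiM_past)
    then show ?thesis unfolding G'[OF that] using fin by (intro Max_ge) auto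
  qed
  then show "\<exists>C. \<forall>x\<in>space M. \<bar>G x\<bar> \<le> C" by blast
qed

lemma adapted_integrable:
  fixes G :: "'w \<Rightarrow> real"
  assumes "adapted k G"
  shows "integrable M G"
proof -
  obtain C where "\<forall>x\<in>space M. \<bar>G x\<bar> \<le> C" using adapted_bounded_measurable(2)[OF assms] by blast
  then show ?thesis
    using adapted_bounded_measurable(1)[OF assms]
    by (intro integrable_const_bound[of _ C]) (auto intro!: AE_I2)
qed

lemma adapted_integrable_power2:
  fixes G :: "'w \<Rightarrow> real"
  shows "adapted k G \<Longrightarrow> integrable M (\<lambda>x. (G x)\<^sup>2)"
  by (rule adapted_integrable[OF adapted_comp])

text \<open>The choice at time \<open>k\<close> is independent of everything that happened before.\<close>

lemma expectation_adapted_choice: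
  fixes G :: "'w \<Rightarrow> real"
  assumes G: "adapted k G" and i: "i \<in> K" "\<tau> i = k" and B: "B \<in> \<B>"
  shows "expectation (\<lambda>x. G x * indicator {B} (J i x)) = expectation G / card \<B>"
proof -
  let ?r = "\<lambda>H x. restrict (\<lambda>i. J i x) H"
  obtain G' where G': "\<And>x. x \<in> space M \<Longrightarrow> G x = G' (?r (past k) x)"
    using adapted_factor[OF G] by blast
  have meas: "(\<lambda>u. indicator {B} (u i) :: real) \<in> borel_measurable (PiM {i} (\<lambda>_. count_space \<B>))"
    by (rule measurable_compose[OF measurable_component_singleton]) simp_all
  have meas': "G' \<in> borel_measurable (PiM (past k) (\<lambda>_. count_space \<B>))" by (simp add: PiM_past)
  have "indep_var (PiM (past k) (\<lambda>_. count_space \<B>)) (?r (past k))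
      (PiM {i} (\<lambda>_. count_space \<B>)) (?r {i})"
    using i past_subset by (intro indep_var_restrict[OF indep_choices]) (auto simp: past_def)
  from indep_var_compose[OF this meas' meas]
  have "indep_var borel (\<lambda>x. G' (?r (past k) x)) borel (\<lambda>x. indicator {B} (J i x))"
    by (simp add: comp_def)
  moreover have "integrable M (\<lambda>x. G' (?r (past k) x))"
    by (rule iffD1[OF Bochner_Integration.integrable_cong[OF refl G'] adapted_integrable[OF G]])
  moreover have meas_i: "(\<lambda>x. indicator {B} (J i x) :: real) \<in> borel_measurable M"
    by (rule measurable_compose[OF choices_measurable[OF i(1)]]) simp
  moreover have "integrable M (\<lambda>x. indicator {B} (J i x) :: real)"
    using meas_i by (intro integrable_const_bound[of _ 1]) (auto simp: indicator_def)
  ultimately have "expectation (\<lambda>x. G' (?r (past k) x) * indicator {B} (J i x))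
      = expectation (\<lambda>x. G' (?r (past k) x)) * expectation (\<lambda>x. indicator {B} (J i x))"
    by (intro indep_var_lebesgue_integral)
  also have "expectation (\<lambda>x. indicator {B} (J i x) :: real)
      = integral\<^sup>L (distr M (count_space \<B>) (J i)) (indicator {B})"
    by (rule integral_distr[symmetric]) (use choices_measurable[OF i(1)] in auto)
  also have "\<dots> = 1 / card \<B>"
    unfolding choice_uniform[OF i(1)] using finite_choices B
    by (simp add: measure_uniform_count_measure)
  finally have "expectation (\<lambda>x. G' (?r (past k) x) * indicator {B} (J i x))
      = expectation (\<lambda>x. G' (?r (past k) x)) / card \<B>" by (simp only: times_divide_eq_right mult_1_right)
  moreover have "expectation (\<lambda>x. G x * indicator {B} (J i x))
      = expectation (\<lambda>x. G' (?r (past k) x) * indicator {B} (J i x))"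
    using G' by (intro Bochner_Integration.integral_cong) auto
  moreover have "expectation G = expectation (\<lambda>x. G' (?r (past k) x))"
    using G' by (intro Bochner_Integration.integral_cong) auto
  ultimately show ?thesis by (simp only:)
qed

text \<open>Split according to the value of the present choice: each value has the same probability given the
  past, so the expectation is a multiple of the sum of \<open>h\<close> over all values.\<close>

lemma centred_choice_innovation:
  assumes i: "i \<in> K" "\<tau> i = k"
    and h: "\<And>B. B \<in> \<B> \<Longrightarrow> adapted k (\<lambda>x. h x B)"
    and h0: "\<And>x. x \<in> space M \<Longrightarrow> (\<Sum>B\<in>\<B>. h x B) = 0"
    and \<xi>: "\<And>x. x \<in> space M \<Longrightarrow> \<xi> x = h x (J i x)"
  shows "innovation k \<xi>"
  unfolding innovation_def
proof (intro conjI allI impI)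
  have Ji: "J i x \<in> \<B>" if "x \<in> space M" for x
    using measurable_space[OF choices_measurable[OF i(1)] that] by simp
  show "adapted (Suc k) \<xi>"
    unfolding adapted_def
  proof (intro ballI impI)
    fix x y assume x: "x \<in> space M" and y: "y \<in> space M" and eq: "\<forall>i\<in>past (Suc k). J i x = J i y"
    have "J i x = J i y" using eq i by (simp add: past_def)
    moreover have "\<forall>i\<in>past k. J i x = J i y" using eq past_mono[of k "Suc k"] by auto
    then have "h x (J i x) = h y (J i x)"
      using h[OF Ji[OF x]] x y unfolding adapted_def by blast
    ultimately show "\<xi> x = \<xi> y" using \<xi> x y by simp
  qed
  fix G :: "'w \<Rightarrow> real" assume G: "adapted k G"
  have Gh: "adapted k (\<lambda>x. G x * h x B)" if "B \<in> \<B>" for B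
    using adapted_comp2[OF G h[OF that]] .
  have int: "integrable M (\<lambda>x. G x * h x B * indicator {B} (J i x))" if "B \<in> \<B>" for B
  proof (rule Bochner_Integration.integrable_bound[OF adapted_integrable[OF Gh[OF that]]])
    have "(\<lambda>x. indicator {B} (J i x) :: real) \<in> borel_measurable M"
      by (rule measurable_compose[OF choices_measurable[OF i(1)]]) simp
    then show "(\<lambda>x. G x * h x B * indicator {B} (J i x)) \<in> borel_measurable M"
      using adapted_bounded_measurable(1)[OF Gh[OF that]] by simp
  qed (auto simp: indicator_def)
  have "expectation (\<lambda>x. G x * \<xi> x) = expectation (\<lambda>x. \<Sum>B\<in>\<B>. G x * h x B * indicator {B} (J i x))"
  proof (rule Bochner_Integration.integral_cong[OF refl])
    fix x assume x: "x \<in> space M"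
    have "(\<Sum>B\<in>\<B>. G x * h x B * indicator {B} (J i x)) = (\<Sum>B\<in>\<B>. if B = J i x then G x * h x B else 0)"
      by (intro sum.cong) (auto simp: indicator_def)
    then show "G x * \<xi> x = (\<Sum>B\<in>\<B>. G x * h x B * indicator {B} (J i x))"
      using Ji[OF x] finite_choices \<xi>[OF x] by simp
  qed
  also have "\<dots> = (\<Sum>B\<in>\<B>. expectation (\<lambda>x. G x * h x B) / card \<B>)"
    using int expectation_adapted_choice[OF Gh i]
    by (subst Bochner_Integration.integral_sum) auto
  also have "\<dots> = expectation (\<lambda>x. \<Sum>B\<in>\<B>. G x * h x B) / card \<B>"
    using adapted_integrable[OF Gh]
    by (subst Bochner_Integration.integral_sum) (auto simp: sum_divide_distrib)
  also have "expectation (\<lambda>x. \<Sum>B\<in>\<B>. G x * h x B) = expectation (\<lambda>x. 0)"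
    using h0 by (intro Bochner_Integration.integral_cong) (auto simp: sum_distrib_left[symmetric])
  finally show "expectation (\<lambda>x. G x * \<xi> x) = 0" by simp
qed

lemma zero_innovation:
  assumes "\<And>x. x \<in> space M \<Longrightarrow> \<xi> x = 0"
  shows "innovation k \<xi>"
proof -
  have "expectation (\<lambda>x. G x * \<xi> x) = expectation (\<lambda>x. 0)" for G
    using assms by (intro Bochner_Integration.integral_cong) auto
  then show ?thesis using assms by (simp add: innovation_def adapted_def)
qed

lemma innovation_gate:
  assumes "innovation k \<xi>" "adapted k G"
  shows "innovation k (\<lambda>x. G x * \<xi> x)"
  unfolding innovation_def
proof (intro conjI allI impI)
  show "adapted (Suc k) (\<lambda>x. G x * \<xi> x)"
    using assms adapted_mono[of k G "Suc k"] by (auto simp: innovation_def intro: adapted_comp2)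
  fix G' :: "'w \<Rightarrow> real" assume "adapted k G'"
  then have "adapted k (\<lambda>x. G' x * G x)" using assms by (auto intro: adapted_comp2)
  then have "expectation (\<lambda>x. (G' x * G x) * \<xi> x) = 0" using assms by (simp add: innovation_def)
  then show "expectation (\<lambda>x. G' x * (G x * \<xi> x)) = 0" by (simp add: mult.assoc)
qed

lemma adapted_innovation_sum:
  assumes "\<And>k. innovation k (\<xi> k)"
  shows "adapted q (\<lambda>x. \<Sum>k=p..<q. \<xi> k x)"
proof (rule adapted_sum)
  fix j assume "j \<in> {p..<q}"
  then have "Suc j \<le> q" by simp
  moreover have "adapted (Suc j) (\<xi> j)" using assms by (simp add: innovation_def)
  ultimately show "adapted q (\<xi> j)" by (rule adapted_mono[rotated])
qed

text \<open>The cross terms vanish because the partial sums are functions of the past.\<close>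

lemma innovation_orthogonality:
  assumes \<xi>: "\<And>k. innovation k (\<xi> k)" and "p \<le> q"
  shows "expectation (\<lambda>x. (\<Sum>k=p..<q. \<xi> k x)\<^sup>2) = (\<Sum>k=p..<q. expectation (\<lambda>x. (\<xi> k x)\<^sup>2))"
  using \<open>p \<le> q\<close>
proof (induction q rule: dec_induct)
  case (step q)
  let ?S = "\<lambda>x. \<Sum>k=p..<q. \<xi> k x"
  have S: "adapted q ?S" by (rule adapted_innovation_sum[OF \<xi>])
  then have S': "adapted (Suc q) ?S" by (rule adapted_mono) simp
  have \<xi>q: "adapted (Suc q) (\<xi> q)" using \<xi> by (simp add: innovation_def)
  have "expectation (\<lambda>x. (?S x + \<xi> q x)\<^sup>2)
      = expectation (\<lambda>x. (?S x)\<^sup>2 + 2 * (?S x * \<xi> q x) + (\<xi> q x)\<^sup>2)"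
    by (simp add: power2_sum algebra_simps)
  also have "\<dots> = expectation (\<lambda>x. (?S x)\<^sup>2) + 2 * expectation (\<lambda>x. ?S x * \<xi> q x)
      + expectation (\<lambda>x. (\<xi> q x)\<^sup>2)"
  proof -
    have "integrable M (\<lambda>x. (?S x)\<^sup>2)" "integrable M (\<lambda>x. ?S x * \<xi> q x)" "integrable M (\<lambda>x. (\<xi> q x)\<^sup>2)"
      by (rule adapted_integrable[OF adapted_comp[OF S']]
          adapted_integrable[OF adapted_comp2[OF S' \<xi>q]] adapted_integrable[OF adapted_comp[OF \<xi>q]])+
    then show ?thesis by simp
  qed
  also have "expectation (\<lambda>x. ?S x * \<xi> q x) = 0" using \<xi> S by (simp add: innovation_def)
  finally show ?case using step by simp
qed simp

text \<open>Kolmogorov's maximal inequality. Stop the partial sums when they first reach the level \<open>\<epsilon>\<close>: the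
  stopped increments are innovations again, and the final stopped sum is at least \<open>\<epsilon>\<close> in absolute
  value whenever one of the partial sums was, so Chebyshev's inequality for the stopped sum suffices.\<close>

lemma maximal_inequality:
  assumes \<xi>: "\<And>k. innovation k (\<xi> k)" and "p \<le> q" and \<epsilon>: "\<epsilon> > 0"
  shows "prob {x \<in> space M. \<exists>n\<in>{p..q}. \<epsilon> \<le> \<bar>\<Sum>k=p..<n. \<xi> k x\<bar>}
    \<le> (\<Sum>k=p..<q. expectation (\<lambda>x. (\<xi> k x)\<^sup>2)) / \<epsilon>\<^sup>2"
proof -
  let ?S = "\<lambda>n x. \<Sum>k=p..<n. \<xi> k x"
  define hit where "hit = (\<lambda>k x. \<exists>n\<in>{p..k}. \<epsilon> \<le> \<bar>?S n x\<bar>)"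
  define \<zeta> where "\<zeta> = (\<lambda>k x. (if hit k x then 0 else 1) * \<xi> k x)"
  have hit_adapted: "adapted k (hit k)" for k
    unfolding adapted_def
  proof (intro ballI impI)
    fix x y assume h: "x \<in> space M" "y \<in> space M" "\<forall>i\<in>past k. J i x = J i y"
    have "?S n x = ?S n y" if "n \<in> {p..k}" for n
    proof -
      have "adapted k (?S n)"
        by (rule adapted_mono[OF adapted_innovation_sum[OF \<xi>]]) (use that in simp)
      then show ?thesis using h unfolding adapted_def by blast
    qed
    then show "hit k x = hit k y" by (simp add: hit_def)
  qed
  have \<zeta>: "innovation k (\<zeta> k)" for k
    unfolding \<zeta>_def by (intro innovation_gate \<xi> adapted_comp[OF hit_adapted])
  let ?Z = "\<lambda>n x. \<Sum>k=p..<n. \<zeta> k x"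
  have stopped: "(if hit n x then \<epsilon> \<le> \<bar>?Z n x\<bar> else ?Z n x = ?S n x)" if "p \<le> n" for n x
    using that
  proof (induction n rule: dec_induct)
    case base
    show ?case using \<epsilon> by (simp add: hit_def)
  next
    case (step n)
    have hit_Suc: "hit (Suc n) x \<longleftrightarrow> hit n x \<or> \<epsilon> \<le> \<bar>?S (Suc n) x\<bar>"
      using step(1) by (auto simp: hit_def atLeastAtMostSuc_conv)
    show ?case
    proof (cases "hit n x")
      case True
      then show ?thesis using step hit_Suc by (simp add: \<zeta>_def)
    next
      case False
      then have "?Z (Suc n) x = ?S (Suc n) x" using step by (simp add: \<zeta>_def)
      then show ?thesis using False hit_Suc by simp
    qed
  qed
  have Zad: "adapted q (?Z q)" by (rule adapted_innovation_sum[OF \<zeta>])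
  let ?E = "{x \<in> space M. hit q x}"
  have "adapted q (\<lambda>x. if hit q x then 1 else 0 :: real)" by (rule adapted_comp[OF hit_adapted])
  from adapted_bounded_measurable(1)[OF this]
  have "{x \<in> space M. (if hit q x then 1 else 0 :: real) = 1} \<in> sets M" by measurable
  moreover have "{x \<in> space M. (if hit q x then 1 else 0 :: real) = 1} = ?E" by auto
  ultimately have E: "?E \<in> sets M" by simp
  have "\<epsilon>\<^sup>2 * prob ?E = expectation (\<lambda>x. \<epsilon>\<^sup>2 * indicator ?E x)" using E by simp
  also have "\<dots> \<le> expectation (\<lambda>x. (?Z q x)\<^sup>2)"
  proof (rule integral_mono)
    show "integrable M (\<lambda>x. \<epsilon>\<^sup>2 * indicator ?E x)" using E by (intro integrable_mult_right integrable_real_indicator) (auto simp: emeasure_eq_measure)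
    show "integrable M (\<lambda>x. (?Z q x)\<^sup>2)" by (rule adapted_integrable_power2[OF Zad])
    fix x
    show "\<epsilon>\<^sup>2 * indicator ?E x \<le> (?Z q x)\<^sup>2"
      using stopped[OF \<open>p \<le> q\<close>, of x] \<epsilon> by (auto simp: indicator_def abs_le_square_iff[symmetric])
  qed
  also have "\<dots> = (\<Sum>k=p..<q. expectation (\<lambda>x. (\<zeta> k x)\<^sup>2))"
    by (rule innovation_orthogonality[OF \<zeta> \<open>p \<le> q\<close>])
  also have "\<dots> \<le> (\<Sum>k=p..<q. expectation (\<lambda>x. (\<xi> k x)\<^sup>2))"
  proof (intro sum_mono integral_mono)
    fix k
    have "adapted (Suc k) (\<zeta> k)" "adapted (Suc k) (\<xi> k)" using \<zeta> \<xi> by (auto simp: innovation_def)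
    then show "integrable M (\<lambda>x. (\<zeta> k x)\<^sup>2)" "integrable M (\<lambda>x. (\<xi> k x)\<^sup>2)"
      by (auto intro: adapted_integrable_power2)
    show "(\<zeta> k x)\<^sup>2 \<le> (\<xi> k x)\<^sup>2" for x by (simp add: \<zeta>_def)
  qed
  finally show ?thesis using \<epsilon> by (simp add: hit_def pos_le_divide_eq mult.commute)
qed

text \<open>The maximal inequality bounds the probability that the partial sums started at \<open>p\<close> ever reach
  \<open>\<epsilon>\<close> by the tail of the variances over \<open>\<epsilon>\<^sup>2\<close>; letting \<open>p\<close> grow shows that the sums are almost surely Cauchy.\<close>

lemma innovation_series_summable:
  assumes \<xi>: "\<And>k. innovation k (\<xi> k)"
    and c: "\<And>k. expectation (\<lambda>x. (\<xi> k x)\<^sup>2) \<le> c k" "summable c"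
  shows "AE x in M. summable (\<lambda>k. \<xi> k x)"
proof -
  let ?S = "\<lambda>p n x. \<Sum>k=p..<n. \<xi> k x"
  have c0: "c k \<ge> 0" for k
    using c(1)[of k] by (rule order.trans[rotated]) (simp add: integral_nonneg_AE)
  have "AE x in M. \<exists>p. \<forall>n\<ge>p. \<bar>?S p n x\<bar> < \<epsilon>" if \<epsilon>: "\<epsilon> > 0" for \<epsilon>
  proof -
    define E where "E = (\<lambda>p q. {x \<in> space M. \<exists>n\<in>{p..q}. \<epsilon> \<le> \<bar>?S p n x\<bar>})"
    have S[measurable]: "?S p n \<in> borel_measurable M" for p n
      by (rule adapted_bounded_measurable(1)[OF adapted_innovation_sum[OF \<xi>]])
    have E[measurable]: "E p q \<in> sets M" for p q unfolding E_def by measurable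
    define U where "U = (\<lambda>p. \<Union>i. E p (p + i))"
    have U[measurable]: "U p \<in> sets M" for p unfolding U_def by measurable
    have le: "prob (U p) \<le> (\<Sum>k. c (k + p)) / \<epsilon>\<^sup>2" for p
    proof (rule LIMSEQ_le_const2)
      have "incseq (\<lambda>i. E p (p + i))"
        by (intro incseq_SucI) (auto simp: E_def)
      then show "(\<lambda>i. prob (E p (p + i))) \<longlonglongrightarrow> prob (U p)"
        unfolding U_def by (intro finite_Lim_measure_incseq) auto
      have "prob (E p (p + i)) \<le> (\<Sum>k. c (k + p)) / \<epsilon>\<^sup>2" for i
      proof -
        have "prob (E p (p + i)) \<le> (\<Sum>k=p..<p + i. expectation (\<lambda>x. (\<xi> k x)\<^sup>2)) / \<epsilon>\<^sup>2"
          unfolding E_def by (rule maximal_inequality[OF \<xi> _ \<epsilon>]) simp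
        also have "\<dots> \<le> (\<Sum>k=p..<p + i. c k) / \<epsilon>\<^sup>2"
          by (intro divide_right_mono sum_mono c) simp
        also have "(\<Sum>k=p..<p + i. c k) = (\<Sum>k<i. c (k + p))"
          using sum.shift_bounds_nat_ivl[of c 0 p i] by (simp add: atLeast0LessThan add.commute)
        also have "\<dots> / \<epsilon>\<^sup>2 \<le> (\<Sum>k. c (k + p)) / \<epsilon>\<^sup>2"
          using c0 c(2) by (intro divide_right_mono sum_le_suminf) (auto simp: summable_iff_shift)
        finally show ?thesis .
      qed
      then show "\<exists>N. \<forall>i\<ge>N. prob (E p (p + i)) \<le> (\<Sum>k. c (k + p)) / \<epsilon>\<^sup>2" by blast
    qed
    define Z where "Z = (\<Inter>p. U p)"
    have Z: "Z \<in> sets M" unfolding Z_def by measurable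
    have "(\<lambda>p. (\<Sum>k. c (k + p)) / \<epsilon>\<^sup>2) \<longlonglongrightarrow> 0 / \<epsilon>\<^sup>2"
      by (intro tendsto_divide suminf_exist_split2 c tendsto_const) (use \<epsilon> in simp)
    then have "prob Z \<le> 0 / \<epsilon>\<^sup>2"
    proof (rule LIMSEQ_le_const)
      have "prob Z \<le> prob (U p)" for p by (rule finite_measure_mono) (auto simp: Z_def)
      then show "\<exists>N. \<forall>p\<ge>N. prob Z \<le> (\<Sum>k. c (k + p)) / \<epsilon>\<^sup>2" using le order.trans by blast
    qed
    then have "prob Z = 0" using measure_nonneg[of M Z] by simp
    then have "AE x in M. x \<notin> Z" using Z prob_eq_0 by blast
    then show ?thesis
    proof (rule AE_mp, intro AE_I2 impI)
      fix x assume x: "x \<in> space M" "x \<notin> Z"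
      then obtain p where p: "x \<notin> U p" by (auto simp: Z_def)
      have "\<bar>?S p n x\<bar> < \<epsilon>" if "n \<ge> p" for n
      proof (rule ccontr)
        assume "\<not> \<bar>?S p n x\<bar> < \<epsilon>"
        then have "x \<in> E p (p + (n - p))" using x that by (auto simp: E_def intro!: bexI[of _ n])
        then show False using p by (auto simp: U_def)
      qed
      then show "\<exists>p. \<forall>n\<ge>p. \<bar>?S p n x\<bar> < \<epsilon>" by blast
    qed
  qed
  then have "AE x in M. \<forall>i. \<exists>p. \<forall>n\<ge>p. \<bar>?S p n x\<bar> < 1 / real (Suc i)"
    unfolding AE_all_countable by simp
  then show ?thesis
  proof (rule AE_mp, intro AE_I2 impI)
    fix x assume *: "\<forall>i. \<exists>p. \<forall>n\<ge>p. \<bar>?S p n x\<bar> < 1 / real (Suc i)"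
    show "summable (\<lambda>k. \<xi> k x)"
      unfolding summable_Cauchy
    proof (intro allI impI)
      fix e :: real assume e: "e > 0"
      then obtain i where i: "1 / real (Suc i) < e / 2" using nat_approx_posE[of "e / 2"] by auto
      obtain p where p: "\<And>n. n \<ge> p \<Longrightarrow> \<bar>?S p n x\<bar> < 1 / real (Suc i)" using * by blast
      have "norm (sum (\<lambda>k. \<xi> k x) {m..<n}) < e" if m: "m \<ge> p" for m n
      proof (cases "m \<le> n")
        case True
        have "?S p n x = ?S p m x + ?S m n x"
          using m True by (simp add: sum.atLeastLessThan_concat)
        then show ?thesis using p[of m] p[of n] m True i by simp
      qed (use e in simp)
      then show "\<exists>N. \<forall>m\<ge>N. \<forall>n. norm (sum (\<lambda>k. \<xi> k x) {m..<n}) < e" by blast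
    qed
  qed
qed

end

section \<open>Sequences with a descent inequality\<close>

lemma summable_of_blocks:
  fixes u :: "nat \<Rightarrow> real"
  assumes u: "\<And>k. u k \<ge> 0" and m: "m > 0" and s: "summable (\<lambda>s. \<Sum>t<m. u (s * m + t))"
  shows "summable u"
proof (rule summableI_nonneg_bounded[OF u])
  fix n
  have blocks: "(\<Sum>k=s * m..<s * m + m. u k) = (\<Sum>t<m. u (s * m + t))" for s
    using sum.shift_bounds_nat_ivl[of u 0 "s * m" m] by (simp add: atLeast0LessThan add.commute)
  have "sum u {..<n} \<le> sum u {..<n * m}" using m u by (intro sum_mono2) auto
  also have "\<dots> = (\<Sum>s<n. \<Sum>t<m. u (s * m + t))"
    unfolding sum.nat_group[symmetric] blocks ..
  also have "\<dots> \<le> (\<Sum>s. \<Sum>t<m. u (s * m + t))"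
    using s u by (intro sum_le_suminf) (auto intro: sum_nonneg)
  finally show "sum u {..<n} \<le> (\<Sum>s. \<Sum>t<m. u (s * m + t))" .
qed

lemma summable_imp_blocks:
  fixes u :: "nat \<Rightarrow> real"
  assumes u: "\<And>k. u k \<ge> 0" and s: "summable u"
  shows "summable (\<lambda>s. \<Sum>t<m. u (s * m + t))"
proof (rule summableI_nonneg_bounded)
  fix n
  have blocks: "(\<Sum>k=s * m..<s * m + m. u k) = (\<Sum>t<m. u (s * m + t))" for s
    using sum.shift_bounds_nat_ivl[of u 0 "s * m" m] by (simp add: atLeast0LessThan add.commute)
  have "(\<Sum>s<n. \<Sum>t<m. u (s * m + t)) = sum u {..<n * m}"
    unfolding sum.nat_group[symmetric] blocks ..
  also have "\<dots> \<le> suminf u" using s u by (intro sum_le_suminf) auto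
  finally show "(\<Sum>s<n. \<Sum>t<m. u (s * m + t)) \<le> suminf u" .
qed (use u in \<open>auto intro: sum_nonneg\<close>)

text \<open>A deterministic form of the Robbins-Siegmund argument: correcting \<open>F\<close> by the partial sums of
  \<open>e\<close> and of \<open>a * N\<close> gives a decreasing sequence that is bounded below.\<close>

lemma descent_sequence_converges:
  fixes F N a e :: "nat \<Rightarrow> real"
  assumes F: "\<And>k. F k \<ge> 0" and N: "\<And>k. N k \<ge> 0" and a: "\<And>k. a k \<ge> 0"
    and a_sum: "\<not> summable a" and a_sq: "summable (\<lambda>k. (a k)\<^sup>2)" and e: "summable e"
    and \<kappa>: "\<kappa> > 0" and desc: "\<And>k. F (Suc k) \<le> F k - \<kappa> * (a k * N k) + e k"
    and lip: "\<And>k. \<bar>N (Suc k) - N k\<bar> \<le> L * a k"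
  shows "convergent F" and "N \<longlonglongrightarrow> 0"
proof -
  let ?E = "\<lambda>k. \<Sum>j<k. e j" and ?A = "\<lambda>k. \<Sum>j<k. a j * N j"
  define W where "W = (\<lambda>k. F k - ?E k + \<kappa> * ?A k)"
  have dec: "decseq W"
    using desc by (intro decseq_SucI) (simp add: W_def algebra_simps)
  have A0: "?A k \<ge> 0" for k using a N by (intro sum_nonneg) auto
  have "Bseq ?E" using e by (simp add: summable_iff_convergent convergent_imp_Bseq)
  then obtain C where C: "\<And>k. \<bar>?E k\<bar> \<le> C" unfolding Bseq_def by auto
  have "- C \<le> W k" for k
  proof -
    have "0 \<le> \<kappa> * ?A k" using A0 \<kappa> by simp
    then show ?thesis using C[of k] F[of k] unfolding W_def by linarith
  qed
  then obtain w where w: "W \<longlonglongrightarrow> w" using decseq_convergent[OF dec] by blast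
  have aN: "summable (\<lambda>k. a k * N k)"
  proof (rule summableI_nonneg_bounded)
    fix k
    have "W k \<le> W 0" using dec by (simp add: decseq_def)
    then have "\<kappa> * ?A k \<le> F 0 + C" using C[of k] F[of k] unfolding W_def by auto
    then show "?A k \<le> (F 0 + C) / \<kappa>" using \<kappa> by (simp add: pos_le_divide_eq mult.commute)
  qed (use a N in auto)
  have "F = (\<lambda>k. W k + ?E k - \<kappa> * ?A k)" by (simp add: W_def)
  moreover have "(\<lambda>k. W k + ?E k - \<kappa> * ?A k) \<longlonglongrightarrow> w + suminf e - \<kappa> * (\<Sum>k. a k * N k)"
    by (intro tendsto_intros w summable_LIMSEQ e aN)
  ultimately show "convergent F" by (metis convergentI)
  (* an increment of the square of N carries a factor N, so that it is bounded by a * N + a^2 *)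
  have "summable (\<lambda>k. (N (Suc k))\<^sup>2 - (N k)\<^sup>2)"
  proof (rule summable_comparison_test)
    show "summable (\<lambda>k. \<bar>L\<bar> * (2 * (a k * N k) + \<bar>L\<bar> * (a k)\<^sup>2))"
      by (intro summable_mult summable_add aN a_sq)
    have "\<bar>(N (Suc k))\<^sup>2 - (N k)\<^sup>2\<bar> \<le> \<bar>L\<bar> * (2 * (a k * N k) + \<bar>L\<bar> * (a k)\<^sup>2)" for k
    proof -
      have d: "\<bar>N (Suc k) - N k\<bar> \<le> \<bar>L\<bar> * a k"
        using lip[of k] mult_right_mono[OF abs_ge_self[of L] a[of k]] by linarith
      have "\<bar>(N (Suc k))\<^sup>2 - (N k)\<^sup>2\<bar> = \<bar>N (Suc k) - N k\<bar> * (N (Suc k) + N k)"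
        using N by (simp add: power2_eq_square square_diff_square_factored abs_mult)
      also have "\<dots> \<le> (\<bar>L\<bar> * a k) * (2 * N k + \<bar>L\<bar> * a k)"
        using d N[of k] N[of "Suc k"] a[of k] by (intro mult_mono) auto
      finally show ?thesis by (simp add: power2_eq_square algebra_simps)
    qed
    then show "\<exists>M. \<forall>k\<ge>M. norm ((N (Suc k))\<^sup>2 - (N k)\<^sup>2) \<le> \<bar>L\<bar> * (2 * (a k * N k) + \<bar>L\<bar> * (a k)\<^sup>2)"
      by simp
  qed
  then have "(\<lambda>n. (\<Sum>k<n. (N (Suc k))\<^sup>2 - (N k)\<^sup>2) + (N 0)\<^sup>2)
      \<longlonglongrightarrow> (\<Sum>k. (N (Suc k))\<^sup>2 - (N k)\<^sup>2) + (N 0)\<^sup>2"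
    by (intro tendsto_add tendsto_const summable_LIMSEQ)
  moreover have "(\<Sum>k<n. (N (Suc k))\<^sup>2 - (N k)\<^sup>2) = (N n)\<^sup>2 - (N 0)\<^sup>2" for n
    by (rule sum_lessThan_telescope)
  ultimately obtain l where l: "(\<lambda>n. (N n)\<^sup>2) \<longlonglongrightarrow> l" by auto
  from tendsto_real_sqrt[OF l] N have sl: "N \<longlonglongrightarrow> sqrt l" by simp
  have "\<not> sqrt l > 0"
  proof
    assume pos: "sqrt l > 0"
    then have "\<forall>\<^sub>F k in sequentially. N k > sqrt l / 2" by (intro order_tendstoD(1)[OF sl]) simp
    then have "\<forall>\<^sub>F k in sequentially. norm (a k) \<le> 2 / sqrt l * (a k * N k)"
    proof eventually_elim
      case (elim k)
      then have "a k * (sqrt l / 2) \<le> a k * N k" using a by (intro mult_left_mono) auto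
      then show ?case using pos a[of k] by (simp add: field_simps)
    qed
    then have "summable a" by (rule summable_comparison_test_ev) (intro summable_mult aN)
    then show False using a_sum by simp
  qed
  moreover have "sqrt l \<ge> 0" using LIMSEQ_le_const[OF sl, of 0] N by auto
  ultimately show "N \<longlonglongrightarrow> 0" using sl by simp
qed

section \<open>The search directions of the method\<close>

lemma Ck_map_on_Suc_imp: "Ck_map_on (Suc k) A B W F \<Longrightarrow> Ck_map_on k A B W F"
  unfolding Ck_map_on_def Let_def using Ck_on_Suc_imp by blast

lemma grad_weighted_sum:
  assumes g: "riemannian_manifold A g"
    and fs: "\<And>i. i \<in> I \<Longrightarrow> Ck_map_on 2 A id_atlas UNIV (fs i)"
    and f: "f = (\<lambda>p. r * (\<Sum>i\<in>I. fs i p))" "Ck_map_on 2 A id_atlas UNIV f"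
  shows "grad A g f p = r *\<^sub>R (\<Sum>i\<in>I. grad A g (fs i) p)"
proof (rule grad_unique[OF g, of 1, symmetric])
  have atlas: "smooth_atlas A" and bil: "bilinear (g p)"
    using g unfolding riemannian_manifold_def by blast+
  show "Ck_map_on (Suc 1) A id_atlas UNIV f" using f(2) by (simp only: numeral_2_eq_2 One_nat_def)
  fix w
  let ?c = "chart_at A p"
  note c = chart_at[OF atlas, of p]
  let ?D = "\<lambda>F. frechet_derivative (F \<circ> chart_inv ?c) (at (snd ?c p))"
  have D: "((fs i \<circ> chart_inv ?c) has_derivative ?D (fs i)) (at (snd ?c p))" if "i \<in> I" for i
    using Ck_map_on_in_chart[OF atlas fs[OF that] c(1)] c(2)
    by (simp add: numeral_2_eq_2 frechet_derivative_works)
  have "((\<lambda>y. r * (\<Sum>i\<in>I. (fs i \<circ> chart_inv ?c) y)) has_derivative (\<lambda>w. r * (\<Sum>i\<in>I. ?D (fs i) w)))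
      (at (snd ?c p))"
    by (intro has_derivative_mult_right has_derivative_sum D)
  then have "((f \<circ> chart_inv ?c) has_derivative (\<lambda>w. r * (\<Sum>i\<in>I. ?D (fs i) w))) (at (snd ?c p))"
    by (simp add: f(1) comp_def)
  from differential_in_chart[OF atlas c this]
  have "differential A f p w = r * (\<Sum>i\<in>I. ?D (fs i) (tcoord A ?c p w))" .
  also have "\<dots> = r * (\<Sum>i\<in>I. g p (grad A g (fs i) p) w)"
  proof (intro arg_cong[where f = "\<lambda>x. r * x"] sum.cong refl)
    fix i assume i: "i \<in> I"
    have "g p (grad A g (fs i) p) w = differential A (fs i) p w"
      using grad_inner[OF g, of 1 "fs i"] fs[OF i] by (simp only: numeral_2_eq_2 One_nat_def)
    then show "?D (fs i) (tcoord A ?c p w) = g p (grad A g (fs i) p) w"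
      using differential_in_chart[OF atlas c D[OF i]] by simp
  qed
  also have "\<dots> = g p (r *\<^sub>R (\<Sum>i\<in>I. grad A g (fs i) p)) w"
  proof -
    have lin: "linear (\<lambda>v. g p v w)" using bil unfolding bilinear_def by blast
    show ?thesis by (simp only: linear_cmul[OF lin] linear_sum[OF lin] real_scaleR_def)
  qed
  finally show "g p (r *\<^sub>R (\<Sum>i\<in>I. grad A g (fs i) p)) w = differential A f p w" by simp
qed

text \<open>Each element of \<open>S\<close> belongs to the same number of subsets of cardinality \<open>b\<close>, namely
  \<open>card S - 1 choose (b - 1)\<close>.\<close>

lemma sum_subset_means:
  fixes x :: "'i \<Rightarrow> 'v::real_vector"
  assumes S: "finite S" and b: "1 \<le> b"
  shows "(\<Sum>B\<in>{B. B \<subseteq> S \<and> card B = b}. (1 / real (card B)) *\<^sub>R (\<Sum>i\<in>B. x i))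
    = (real (card {B. B \<subseteq> S \<and> card B = b}) / real (card S)) *\<^sub>R (\<Sum>i\<in>S. x i)"
proof (cases "S = {}")
  case False
  let ?\<B> = "{B. B \<subseteq> S \<and> card B = b}"
  have fin: "finite ?\<B>" using S by simp
  have n: "card S > 0" using S False by (simp add: card_gt_0_iff)
  have card_i: "real (card {B\<in>?\<B>. i \<in> B}) = real b * real (card ?\<B>) / real (card S)" if i: "i \<in> S" for i
  proof -
    have "{B\<in>?\<B>. i \<in> B} = insert i ` {C. C \<subseteq> S - {i} \<and> card C = b - 1}"
    proof (intro equalityI subsetI)
      fix B assume B: "B \<in> {B\<in>?\<B>. i \<in> B}"
      then have "finite B" using S finite_subset by blast
      then have "B - {i} \<subseteq> S - {i} \<and> card (B - {i}) = b - 1" using B by auto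
      moreover have "B = insert i (B - {i})" using B by auto
      ultimately show "B \<in> insert i ` {C. C \<subseteq> S - {i} \<and> card C = b - 1}" by blast
    next
      fix B assume "B \<in> insert i ` {C. C \<subseteq> S - {i} \<and> card C = b - 1}"
      then obtain C where C: "B = insert i C" "C \<subseteq> S - {i}" "card C = b - 1" by blast
      then have "finite C" "i \<notin> C" using S finite_subset by blast+
      then show "B \<in> {B\<in>?\<B>. i \<in> B}" using C i b by auto
    qed
    moreover have "inj_on (insert i) {C. C \<subseteq> S - {i} \<and> card C = b - 1}"
      by (rule inj_onI) blast
    ultimately have "card {B\<in>?\<B>. i \<in> B} = card {C. C \<subseteq> S - {i} \<and> card C = b - 1}"
      by (simp add: card_image)
    also have "\<dots> = (card S - 1) choose (b - 1)" using n_subsets[of "S - {i}" "b - 1"] S i by simp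
    finally have 1: "card {B\<in>?\<B>. i \<in> B} = (card S - 1) choose (b - 1)" .
    have "b * card ?\<B> = card S * ((card S - 1) choose (b - 1))"
      using n_subsets[OF S, of b] times_binomial_minus1_eq[of b "card S"] b by simp
    then have "real b * real (card ?\<B>) = real (card S) * real (card {B\<in>?\<B>. i \<in> B})"
      unfolding 1 by (metis of_nat_mult)
    then show ?thesis using n by (simp add: field_simps)
  qed
  have "(\<Sum>B\<in>?\<B>. (1 / real (card B)) *\<^sub>R (\<Sum>i\<in>B. x i)) = (1 / real b) *\<^sub>R (\<Sum>B\<in>?\<B>. \<Sum>i\<in>B. x i)"
    by (simp add: scaleR_sum_right)
  also have "(\<Sum>B\<in>?\<B>. \<Sum>i\<in>B. x i) = (\<Sum>B\<in>?\<B>. \<Sum>i | i \<in> S \<and> i \<in> B. x i)"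
    by (intro sum.cong refl) (auto intro!: arg_cong[where f = "sum x"])
  also have "\<dots> = (\<Sum>i\<in>S. \<Sum>B | B \<in> ?\<B> \<and> i \<in> B. x i)"
    by (rule sum.swap_restrict[OF fin S])
  also have "\<dots> = (\<Sum>i\<in>S. (real b * real (card ?\<B>) / real (card S)) *\<^sub>R x i)"
    using card_i by (intro sum.cong refl) (simp add: sum_constant_scaleR)
  also have "\<dots> = (real b * real (card ?\<B>) / real (card S)) *\<^sub>R (\<Sum>i\<in>S. x i)"
    by (simp add: scaleR_sum_right)
  finally show ?thesis using b by simp
qed (use b in auto)

locale shg_method =
  fixes A :: "('a::{t2_space,second_countable_topology}, 'e::euclidean_space) chart set"
    and g :: "'a \<Rightarrow> 'e \<Rightarrow> 'e \<Rightarrow> real"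
    and R :: "'a \<Rightarrow> 'e \<Rightarrow> 'a"
    and T :: "'a \<Rightarrow> 'e \<Rightarrow> 'e \<Rightarrow> 'e"
    and n b :: nat and fs :: "nat \<Rightarrow> 'a \<Rightarrow> real" and f :: "'a \<Rightarrow> real"
    and \<rho> \<mu> :: real
  assumes manifold: "riemannian_manifold A g"
    and transport_linear: "linear (T p \<eta>)"
    and transport_isometric: "g (R p \<eta>) (T p \<eta> \<xi>) (T p \<eta> \<zeta>) = g p \<xi> \<zeta>"
    and n: "n \<ge> 1" and b: "1 \<le> b" "b \<le> n"
    and mean: "f = (\<lambda>p. (1 / real n) * (\<Sum>i=1..n. fs i p))"
    and f_C2: "Ck_map_on 2 A id_atlas UNIV f"
    and fs_C2: "i \<in> {1..n} \<Longrightarrow> Ck_map_on 2 A id_atlas UNIV (fs i)"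
    and \<mu>: "0 < \<mu>" "\<mu> < 1"
begin

abbreviation batches :: "nat set set" where
  "batches \<equiv> {B. B \<subseteq> {1..n} \<and> card B = b}"

abbreviation gf :: "'a \<Rightarrow> 'e" where "gf \<equiv> grad A g f"

text \<open>One inner step: at the point \<open>p\<close>, reached from \<open>p'\<close> by a step of size \<open>\<alpha>'\<close> along \<open>- V'\<close>, in an
  epoch that began at \<open>p0\<close>. The truncation \<open>weight\<close> of \<open>\<psi>\<close> is the coefficient of the recursive
  part of the direction.\<close>

definition correlation :: "real \<Rightarrow> 'a \<Rightarrow> 'e \<Rightarrow> 'a \<Rightarrow> real" where
  "correlation \<alpha>' p' V' p = g p (T p' (- (\<alpha>' *\<^sub>R V')) (V' - gf p')) (gf p)"

definition weight :: "real \<Rightarrow> real \<Rightarrow> 'a \<Rightarrow> 'e \<Rightarrow> 'a \<Rightarrow> real" where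
  "weight \<psi> \<alpha>' p' V' p = (let D = correlation \<alpha>' p' V' p in
     if D \<noteq> 0 then min \<psi> (\<mu> * (tnorm g p (gf p))\<^sup>2 / \<bar>D\<bar>) else \<psi>)"

definition direction ::
  "bool \<Rightarrow> real \<Rightarrow> real \<Rightarrow> real \<Rightarrow> 'a \<Rightarrow> 'a \<Rightarrow> 'e \<Rightarrow> 'a \<Rightarrow> nat set \<Rightarrow> 'e" where
  "direction first \<phi> \<psi> \<alpha>' p0 p' V' p B =
     (let gB = batch_grad A g fs B;
          step = - (\<alpha>' *\<^sub>R V');
          \<eta> = (if first then step else inv_into (tball g p0 \<rho>) (R p0) p);
          \<psi>' = weight \<psi> \<alpha>' p' V' p
      in \<phi> *\<^sub>R (gB p - T p0 \<eta> (gB p0 - gf p0)) + \<psi>' *\<^sub>R (gB p - T p' step (gB p' - V')) +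
         (1 - \<phi> - \<psi>') *\<^sub>R gB p)"

text \<open>The mean over all index sets of the pairing of the direction with the gradient.\<close>

definition drift :: "real \<Rightarrow> real \<Rightarrow> 'a \<Rightarrow> 'e \<Rightarrow> 'a \<Rightarrow> real" where
  "drift \<psi> \<alpha>' p' V' p = (tnorm g p (gf p))\<^sup>2 + weight \<psi> \<alpha>' p' V' p * correlation \<alpha>' p' V' p"

lemma bilinear_metric: "bilinear (g p)"
  using manifold unfolding riemannian_manifold_def by blast

lemma weight_bounds:
  assumes "\<psi> \<ge> 0"
  shows "0 \<le> weight \<psi> \<alpha>' p' V' p" "weight \<psi> \<alpha>' p' V' p \<le> \<psi>"
  using assms \<mu> by (auto simp: weight_def Let_def)

text \<open>By the truncation, the product of weight and correlation is in absolute value at most \<open>\<mu>\<close> times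
  the squared norm of the gradient.\<close>

lemma drift_bounds:
  assumes \<psi>: "\<psi> \<ge> 0"
  shows "(1 - \<mu>) * (tnorm g p (gf p))\<^sup>2 \<le> drift \<psi> \<alpha>' p' V' p"
    and "\<bar>drift \<psi> \<alpha>' p' V' p\<bar> \<le> 2 * (tnorm g p (gf p))\<^sup>2"
proof -
  let ?D = "correlation \<alpha>' p' V' p" and ?w = "weight \<psi> \<alpha>' p' V' p" and ?N = "(tnorm g p (gf p))\<^sup>2"
  have "\<bar>?w * ?D\<bar> \<le> \<mu> * ?N"
  proof (cases "?D = 0")
    case False
    have "\<bar>?w * ?D\<bar> = ?w * \<bar>?D\<bar>" using weight_bounds[OF \<psi>] by (simp add: abs_mult)
    also have "\<dots> \<le> \<mu> * ?N / \<bar>?D\<bar> * \<bar>?D\<bar>"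
      using False by (intro mult_right_mono) (auto simp: weight_def Let_def)
    also have "\<dots> = \<mu> * ?N" using False by simp
    finally show ?thesis .
  qed (use \<mu> in simp)
  moreover have "\<mu> * ?N \<le> 1 * ?N" using \<mu> by (intro mult_right_mono) auto
  ultimately show "(1 - \<mu>) * ?N \<le> drift \<psi> \<alpha>' p' V' p" "\<bar>drift \<psi> \<alpha>' p' V' p\<bar> \<le> 2 * ?N"
    unfolding drift_def left_diff_distrib by linarith+
qed

lemma sum_batch_grad: "(\<Sum>B\<in>batches. batch_grad A g fs B p) = real (card batches) *\<^sub>R gf p"
proof -
  have "gf p = (1 / real n) *\<^sub>R (\<Sum>i=1..n. grad A g (fs i) p)"
    by (rule grad_weighted_sum[OF manifold fs_C2 mean f_C2])
  then show ?thesis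
    using sum_subset_means[of "{1..n}" b "\<lambda>i. grad A g (fs i) p"] b(1)
    unfolding batch_grad_def by simp
qed

text \<open>The direction is affine in the batch gradients at the three points. After averaging, the correction
  anchored at \<open>p0\<close> cancels, and the recursive one leaves the transported error of \<open>V'\<close>.\<close>

lemma sum_direction:
  "(\<Sum>B\<in>batches. direction first \<phi> \<psi> \<alpha>' p0 p' V' p B) =
     real (card batches) *\<^sub>R
       (gf p + weight \<psi> \<alpha>' p' V' p *\<^sub>R T p' (- (\<alpha>' *\<^sub>R V')) (V' - gf p'))"
proof -
  let ?n = "real (card batches)" and ?w = "weight \<psi> \<alpha>' p' V' p" and ?G = "batch_grad A g fs"
  let ?T' = "T p' (- (\<alpha>' *\<^sub>R V'))"
  let ?T0 = "T p0 (if first then - (\<alpha>' *\<^sub>R V') else inv_into (tball g p0 \<rho>) (R p0) p)"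
  have T0: "(\<Sum>B\<in>batches. ?T0 (?G B p0 - gf p0)) = 0"
  proof -
    have "(\<Sum>B\<in>batches. ?G B p0 - gf p0) = 0"
      by (simp only: sum_subtractf sum_batch_grad sum_constant_scaleR diff_self)
    then show ?thesis
      by (simp only: linear_sum[OF transport_linear, symmetric] linear_0[OF transport_linear])
  qed
  have T': "(\<Sum>B\<in>batches. ?T' (?G B p' - V')) = ?n *\<^sub>R ?T' (gf p' - V')"
  proof -
    have "(\<Sum>B\<in>batches. ?G B p' - V') = ?n *\<^sub>R (gf p' - V')"
      by (simp only: sum_subtractf sum_batch_grad sum_constant_scaleR scaleR_diff_right)
    then show ?thesis
      by (simp only: linear_sum[OF transport_linear, symmetric] linear_cmul[OF transport_linear])
  qed
  have "(\<Sum>B\<in>batches. direction first \<phi> \<psi> \<alpha>' p0 p' V' p B) =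
     \<phi> *\<^sub>R ((\<Sum>B\<in>batches. ?G B p) - (\<Sum>B\<in>batches. ?T0 (?G B p0 - gf p0))) +
     ?w *\<^sub>R ((\<Sum>B\<in>batches. ?G B p) - (\<Sum>B\<in>batches. ?T' (?G B p' - V'))) +
     (1 - \<phi> - ?w) *\<^sub>R (\<Sum>B\<in>batches. ?G B p)"
    unfolding direction_def Let_def sum.distrib scaleR_sum_right[symmetric] sum_subtractf ..
  also have "\<dots> = ?n *\<^sub>R (gf p + ?w *\<^sub>R (- ?T' (gf p' - V')))"
    unfolding T0 T' sum_batch_grad by (simp add: algebra_simps)
  also have "- ?T' (gf p' - V') = ?T' (V' - gf p')"
    using linear_neg[OF transport_linear, of p' "- (\<alpha>' *\<^sub>R V')" "gf p' - V'"] by simp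
  finally show ?thesis .
qed

lemma sum_direction_inner_gradient:
  "(\<Sum>B\<in>batches. g p (direction first \<phi> \<psi> \<alpha>' p0 p' V' p B) (gf p)) =
     real (card batches) * drift \<psi> \<alpha>' p' V' p"
proof -
  have lin: "linear (\<lambda>v. g p v (gf p))" using bilinear_metric unfolding bilinear_def by blast
  show ?thesis
    unfolding linear_sum[OF lin, symmetric] sum_direction
    by (simp add: bilinear_ladd[OF bilinear_metric] bilinear_lmul[OF bilinear_metric]
        drift_def correlation_def tnorm_sq[OF manifold])
qed

lemma tnorm_diff: "tnorm g p (v - w) \<le> tnorm g p v + tnorm g p w"
  using tnorm_triangle[OF manifold, of p v "- w"] tnorm_scaleR[OF manifold, of p "-1" w] by simp

lemma tnorm_batch_grad:
  assumes B: "B \<in> batches" and C: "\<And>i. i \<in> {1..n} \<Longrightarrow> tnorm g p (grad A g (fs i) p) \<le> C"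
  shows "tnorm g p (batch_grad A g fs B p) \<le> C"
proof -
  have sum_le: "tnorm g p (\<Sum>i\<in>B'. grad A g (fs i) p) \<le> real (card B') * C"
    if "finite B'" "B' \<subseteq> {1..n}" for B'
    using that
  proof (induction B' rule: finite_induct)
    case empty
    show ?case by (simp add: tnorm_def bilinear_lzero[OF bilinear_metric])
  next
    case (insert i B')
    have "tnorm g p (grad A g (fs i) p + (\<Sum>i\<in>B'. grad A g (fs i) p)) \<le> C + real (card B') * C"
      using tnorm_triangle[OF manifold] insert C by (meson add_mono insert_subset order.trans)
    then show ?case using insert by (simp add: algebra_simps)
  qed
  have "finite B" "B \<subseteq> {1..n}" "card B = b" using B finite_subset[of B "{1..n}"] by auto
  then show ?thesis
    using sum_le[of B] b(1)
    by (simp add: batch_grad_def tnorm_scaleR[OF manifold] pos_divide_le_eq mult.commute)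
qed

text \<open>The direction is a convex combination of three vectors, of which only the second involves \<open>V'\<close>.\<close>

lemma tnorm_direction:
  assumes B: "B \<in> batches"
    and C: "\<And>i q. i \<in> {1..n} \<Longrightarrow> q \<in> {p, p0, p'} \<Longrightarrow> tnorm g q (grad A g (fs i) q) \<le> C"
      "tnorm g p0 (gf p0) \<le> C"
    and \<phi>\<psi>: "\<phi> \<ge> 0" "\<psi> \<ge> 0" "\<phi> + \<psi> \<le> 1"
    and p: "R p' (- (\<alpha>' *\<^sub>R V')) = p"
      "R p0 (if first then - (\<alpha>' *\<^sub>R V') else inv_into (tball g p0 \<rho>) (R p0) p) = p"
  shows "tnorm g p (direction first \<phi> \<psi> \<alpha>' p0 p' V' p B) \<le> 3 * C + tnorm g p' V'"
proof -
  let ?w = "weight \<psi> \<alpha>' p' V' p" and ?G = "batch_grad A g fs B"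
  let ?T' = "T p' (- (\<alpha>' *\<^sub>R V'))" and ?t = "tnorm g"
  let ?T0 = "T p0 (if first then - (\<alpha>' *\<^sub>R V') else inv_into (tball g p0 \<rho>) (R p0) p)"
  note w = weight_bounds[OF \<phi>\<psi>(2), of \<alpha>' p' V' p]
  have G: "?t q (?G q) \<le> C" if "q \<in> {p, p0, p'}" for q
    using tnorm_batch_grad[OF B] C(1) that by blast
  have C0: "C \<ge> 0" using tnorm_nonneg[OF manifold, of p0 "gf p0"] C(2) by linarith
  have V': "?t p' V' \<ge> 0" by (rule tnorm_nonneg[OF manifold])
  have T': "?t p (?T' \<xi>) = ?t p' \<xi>" for \<xi>
    using transport_isometric[of p' "- (\<alpha>' *\<^sub>R V')" \<xi> \<xi>] by (simp add: tnorm_def p(1))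
  have T0: "?t p (?T0 \<xi>) = ?t p0 \<xi>" for \<xi>
    using transport_isometric[of p0 _ \<xi> \<xi>, of "if first then - (\<alpha>' *\<^sub>R V') else inv_into (tball g p0 \<rho>) (R p0) p"]
    unfolding tnorm_def p(2) by simp
  have 1: "?t p (?G p - ?T0 (?G p0 - gf p0)) \<le> 3 * C"
    using tnorm_diff[of p "?G p" "?T0 (?G p0 - gf p0)"] tnorm_diff[of p0 "?G p0" "gf p0"]
      G[of p] G[of p0] C(2) by (simp add: T0)
  have 2: "?t p (?G p - ?T' (?G p' - V')) \<le> 2 * C + ?t p' V'"
    using tnorm_diff[of p "?G p" "?T' (?G p' - V')"] tnorm_diff[of p' "?G p'" V']
      G[of p] G[of p'] by (simp add: T')
  have "?t p (direction first \<phi> \<psi> \<alpha>' p0 p' V' p B) \<le>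
      \<phi> * ?t p (?G p - ?T0 (?G p0 - gf p0)) + ?w * ?t p (?G p - ?T' (?G p' - V')) +
      (1 - \<phi> - ?w) * ?t p (?G p)"
    unfolding direction_def Let_def
    using w \<phi>\<psi>
    by (intro order.trans[OF tnorm_triangle[OF manifold]] add_mono)
      (simp_all add: tnorm_scaleR[OF manifold])
  also have "\<dots> \<le> \<phi> * (3 * C + ?t p' V') + ?w * (3 * C + ?t p' V') + (1 - \<phi> - ?w) * (3 * C + ?t p' V')"
    using 1 2 G[of p] w \<phi>\<psi> C0 V' by (intro add_mono mult_left_mono) auto
  also have "\<dots> = 3 * C + ?t p' V'" by (simp add: algebra_simps)
  finally show ?thesis .
qed

end

section \<open>Almost sure convergence\<close>

text \<open>The last point of an epoch is the first one of the next, so the pairs \<open>(s, t)\<close> with \<open>t < m\<close>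
  enumerate the trajectory as one sequence that obeys a single recursion.\<close>

lemma (in shg_method) run_flattened:
  assumes run: "rshg_run A g R T \<rho> fs f \<alpha> \<phi> \<psi> \<mu> m \<omega>init J \<omega> V" and m: "m \<ge> 1"
  defines "w \<equiv> \<lambda>k. \<omega> (k div m + 1) (k mod m)" and "v \<equiv> \<lambda>k. V (k div m + 1) (k mod m)"
    and "a \<equiv> \<lambda>k. \<alpha> (k div m + 1) (k mod m)"
  shows "w 0 = \<omega>init"
    and "w (Suc k) = R (w k) (- (a k *\<^sub>R v k))"
    and "k mod m = 0 \<Longrightarrow> v k = gf (w k)"
    and "k mod m \<noteq> 0 \<Longrightarrow> v k = direction (k mod m = 1) (\<phi> (k div m + 1) (k mod m))
      (\<psi> (k div m + 1) (k mod m)) (a (k - 1)) (w (k - k mod m)) (w (k - 1)) (v (k - 1)) (w k)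
      (J (k div m + 1) (k mod m))"
proof -
  have r1: "\<omega> s 0 = (if s = 1 then \<omega>init else \<omega> (s - 1) m)" "V s 0 = gf (\<omega> s 0)"
    and r2: "t < m \<Longrightarrow> \<omega> s (t + 1) = R (\<omega> s t) (- (\<alpha> s t *\<^sub>R V s t))"
    if "s \<ge> 1" for s t
    using run that unfolding rshg_run_def by blast+
  have r3: "V s t = direction (t = 1) (\<phi> s t) (\<psi> s t) (\<alpha> s (t - 1)) (\<omega> s 0) (\<omega> s (t - 1))
      (V s (t - 1)) (\<omega> s t) (J s t)" if "s \<ge> 1" "t \<in> {1..<m}" for s t
    using run that unfolding rshg_run_def direction_def weight_def correlation_def Let_def by blast
  show "w 0 = \<omega>init" using r1[of 1] by (simp add: w_def)
  show "w (Suc k) = R (w k) (- (a k *\<^sub>R v k))"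
  proof (cases "Suc (k mod m) = m")
    case True
    then have "Suc k mod m = 0" "Suc k div m = Suc (k div m)" by (simp_all add: mod_Suc div_Suc)
    then have "w (Suc k) = \<omega> (k div m + 1) (k mod m + 1)"
      using r1(1)[of "Suc (k div m) + 1"] True by (simp add: w_def)
    then show ?thesis using r2[of "k div m + 1" "k mod m"] m by (simp add: w_def v_def a_def)
  next
    case False
    then have "Suc k mod m = Suc (k mod m)" "Suc k div m = k div m" by (simp_all add: mod_Suc div_Suc)
    then have "w (Suc k) = \<omega> (k div m + 1) (k mod m + 1)" by (simp add: w_def)
    then show ?thesis using r2[of "k div m + 1" "k mod m"] m by (simp add: w_def v_def a_def)
  qed
  show "v k = gf (w k)" if "k mod m = 0" using that r1(2)[of "k div m + 1"] by (simp add: w_def v_def)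
  assume k: "k mod m \<noteq> 0"
  have "m * (k div m) \<le> k - 1"
    using k mult_div_mod_eq[of m k] by linarith
  moreover have "k - 1 = m * (k div m) + (k mod m - 1)" "k - k mod m = m * (k div m)"
    using k mult_div_mod_eq[of m k] by linarith+
  moreover have "k mod m < m" "k mod m - 1 < m" using m by (simp_all add: less_imp_diff_less)
  ultimately have prev: "(k - 1) div m = k div m" "(k - 1) mod m = k mod m - 1"
    "(k - k mod m) div m = k div m" "(k - k mod m) mod m = 0"
    using m by (simp_all add: div_mult_self2 mod_mult_self2)
  show "v k = direction (k mod m = 1) (\<phi> (k div m + 1) (k mod m))
      (\<psi> (k div m + 1) (k mod m)) (a (k - 1)) (w (k - k mod m)) (w (k - 1)) (v (k - 1)) (w k)
      (J (k div m + 1) (k mod m))"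
    unfolding w_def v_def a_def prev using k m by (intro r3) auto
qed

text \<open>The bound grows by \<open>3 * C\<close> per step and starts afresh in every epoch. The hypothesis \<open>reach\<close>
  makes the vector chosen by \<open>inv_into\<close> end at the current point, so that the transport from the
  start of the epoch is an isometry into the tangent space there.\<close>

lemma (in shg_method) directions_bounded:
  assumes step: "\<And>k. w (Suc k) = R (w k) (- (a k *\<^sub>R v k))"
    and v0: "\<And>k. k mod m = 0 \<Longrightarrow> v k = gf (w k)"
    and v1: "\<And>k. k mod m \<noteq> 0 \<Longrightarrow> v k = direction (k mod m = 1) (\<phi> k) (\<psi> k) (a (k - 1))
        (w (k - k mod m)) (w (k - 1)) (v (k - 1)) (w k) (J k)"
    and J: "\<And>k. k mod m \<noteq> 0 \<Longrightarrow> J k \<in> batches"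
    and \<phi>\<psi>: "\<And>k. k mod m \<noteq> 0 \<Longrightarrow> \<phi> k \<ge> 0 \<and> \<psi> k \<ge> 0 \<and> \<phi> k + \<psi> k \<le> 1"
    and w: "\<And>k. w k \<in> \<Omega>"
    and reach: "\<And>p. p \<in> \<Omega> \<Longrightarrow> \<Omega> \<subseteq> R p ` tball g p \<rho>"
    and C: "\<And>p i. p \<in> \<Omega> \<Longrightarrow> i \<in> {1..n} \<Longrightarrow> tnorm g p (grad A g (fs i) p) \<le> C"
      "\<And>p. p \<in> \<Omega> \<Longrightarrow> tnorm g p (gf p) \<le> C"
  shows "tnorm g (w k) (v k) \<le> (3 * real (k mod m) + 1) * C"
proof (induction k)
  case 0
  then show ?case using v0[of 0] C(2)[OF w] by simp
next
  case (Suc k)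
  show ?case
  proof (cases "Suc k mod m = 0")
    case True
    then show ?thesis using v0[of "Suc k"] C(2)[OF w] by simp
  next
    case False
    then have mod: "Suc k mod m = Suc (k mod m)" by (simp add: mod_Suc split: if_splits)
    let ?p0 = "w (Suc k - Suc k mod m)"
    have reached: "R ?p0 (if Suc k mod m = 1 then - (a k *\<^sub>R v k)
        else inv_into (tball g ?p0 \<rho>) (R ?p0) (w (Suc k))) = w (Suc k)"
    proof (cases "Suc k mod m = 1")
      case True
      then show ?thesis by (simp add: step)
    next
      case False
      have "w (Suc k) \<in> R ?p0 ` tball g ?p0 \<rho>" using reach[OF w] w by blast
      then show ?thesis using False by (simp add: f_inv_into_f)
    qed
    have "tnorm g (w (Suc k)) (v (Suc k)) \<le> 3 * C + tnorm g (w k) (v k)"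
      unfolding v1[OF False] diff_Suc_1
    proof (rule tnorm_direction[OF J[OF False]])
      fix i q assume "i \<in> {1..n}" "q \<in> {w (Suc k), ?p0, w k}"
      then show "tnorm g q (grad A g (fs i) q) \<le> C" using w C(1) by blast
    qed (use \<phi>\<psi>[OF False] C(2)[OF w] step reached in auto)
    also have "\<dots> \<le> 3 * C + (3 * real (k mod m) + 1) * C" using Suc.IH by simp
    finally show ?thesis by (simp add: mod algebra_simps)
  qed
qed

theorem theorem2:
  fixes A :: "('a::{t2_space,second_countable_topology}, 'e::euclidean_space) chart set"
    and g :: "'a \<Rightarrow> 'e \<Rightarrow> 'e \<Rightarrow> real"
    and R :: "'a \<Rightarrow> 'e \<Rightarrow> 'a"
    and T :: "'a \<Rightarrow> 'e \<Rightarrow> 'e \<Rightarrow> 'e"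
    and n m b :: nat
    and fs :: "nat \<Rightarrow> 'a \<Rightarrow> real" and f :: "'a \<Rightarrow> real"
    and \<omega>star \<omega>init :: 'a and \<Omega> :: "'a set"
    and \<rho> \<mu> :: real
    and \<alpha> \<phi> \<psi> :: "nat \<Rightarrow> nat \<Rightarrow> real"
    and P :: "'w measure"
    and I :: "nat \<Rightarrow> nat \<Rightarrow> 'w \<Rightarrow> nat set"
    and \<omega> :: "nat \<Rightarrow> nat \<Rightarrow> 'w \<Rightarrow> 'a"
    and V :: "nat \<Rightarrow> nat \<Rightarrow> 'w \<Rightarrow> 'e"
  assumes manifold: "riemannian_manifold A g"
    and retraction: "manifold_retraction A R"
    and transport: "vector_transport A R T"
    and n: "n \<ge> 1"
    and f: "f = (\<lambda>p. (1 / real n) * (\<Sum>i=1..n. fs i p))"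
    and minimizer: "\<forall>p. f \<omega>star \<le> f p"
    (* parameters of the algorithm *)
    and m: "m \<ge> 1"
    and b: "1 \<le> b" "b \<le> n"
    and \<mu>: "0 < \<mu>" "\<mu> < 1"
    and \<alpha>: "\<forall>s\<ge>1. \<forall>t<m. \<alpha> s t > 0"
    and \<phi>\<psi>: "\<forall>s\<ge>1. \<forall>t\<in>{1..<m}. \<phi> s t \<ge> 0 \<and> \<psi> s t \<ge> 0 \<and> \<phi> s t + \<psi> s t \<le> 1"
    (* the random index sets *)
    and prob: "prob_space P"
    and I_indep: "prob_space.indep_vars P (\<lambda>_. count_space {B. B \<subseteq> {1..n} \<and> card B = b})
                    (\<lambda>(s, t). I s t) ({1..} \<times> {1..<m})"
    and I_unif: "\<forall>s\<ge>1. \<forall>t\<in>{1..<m}.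
                   distr P (count_space {B. B \<subseteq> {1..n} \<and> card B = b}) (I s t)
                     = uniform_count_measure {B. B \<subseteq> {1..n} \<and> card B = b}"
    and run: "\<forall>x\<in>space P. rshg_run A g R T \<rho> fs f \<alpha> \<phi> \<psi> \<mu> m \<omega>init
                (\<lambda>s t. I s t x) (\<lambda>s t. \<omega> s t x) (\<lambda>s t. V s t x)"
    (* (i) *)
    and f_C3: "Ck_map_on 3 A id_atlas UNIV f"
    and fs_C2: "\<forall>i\<in>{1..n}. Ck_map_on 2 A id_atlas UNIV (fs i)"
    (* (ii) *)
    and \<Omega>: "compact \<Omega>" "\<omega>star \<in> interior \<Omega>"
    and iterates_in_\<Omega>: "AE x in P. \<forall>s\<ge>1. \<forall>t<m. \<omega> s t x \<in> \<Omega>"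
    and \<rho>: "\<rho> > 0"
    and R_diffeo: "\<forall>p\<in>\<Omega>. diffeo_on id_atlas A (tball g p \<rho>) (R p) \<and> \<Omega> \<subseteq> R p ` tball g p \<rho>"
    and segments_in_\<Omega>: "AE x in P. \<forall>s\<ge>1. \<forall>t<m. \<forall>\<tau>\<in>{0..1}.
                           R (\<omega> s t x) (- ((\<tau> * \<alpha> s t) *\<^sub>R V s t x)) \<in> \<Omega>"
    (* (iii) *)
    and \<alpha>_sum: "\<not> summable (\<lambda>s. \<Sum>t<m. \<alpha> (Suc s) t)"
    and \<alpha>_sq_sum: "summable (\<lambda>s. \<Sum>t<m. (\<alpha> (Suc s) t)\<^sup>2)"
    (* (iv) *)
    and T_continuous: "Ck_map_on 0 (tangent2_atlas A) (tangent_atlas A) UNIV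
                         (\<lambda>(p, \<eta>, \<xi>). (R p \<eta>, T p \<eta> \<xi>))"
    and T_isometric: "\<forall>p \<eta> \<xi> \<zeta>. g (R p \<eta>) (T p \<eta> \<xi>) (T p \<eta> \<zeta>) = g p \<xi> \<zeta>"
    and f_nonneg: "\<forall>p. f p \<ge> 0"
  shows "(AE x in P. (\<lambda>k. let p = \<omega> (k div m + 1) (k mod m) x in tnorm g p (grad A g f p))
            \<longlonglongrightarrow> 0) \<and>
         (\<exists>X \<in> borel_measurable P. AE x in P.
            (\<lambda>k. f (\<omega> (k div m + 1) (k mod m) x)) \<longlonglongrightarrow> (X x :: real))"
proof -
  have fs2: "Ck_map_on 2 A id_atlas UNIV (fs i)" if "i \<in> {1..n}" for i using fs_C2 that by blast
  have f2: "Ck_map_on 2 A id_atlas UNIV f"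
    using Ck_map_on_Suc_imp[of 2] f_C3 by (simp only: numeral_3_eq_3 numeral_2_eq_2)
  have T_linear: "linear (T p \<eta>)" for p \<eta> using transport unfolding vector_transport_def by blast
  interpret shg_method A g R T n b fs f \<rho> \<mu>
    by (intro shg_method.intro manifold T_linear T_isometric[rule_format] n b f f2 fs2 \<mu>)
  interpret prob_space P by (rule prob)
  let ?I = "\<lambda>(s, t). I s t" and ?K = "{1..} \<times> {1..<m}" and ?\<tau> = "\<lambda>(s, t). (s - 1) * m + t"
  interpret uniform_choices P ?I ?K ?\<tau> batches
  proof
    show "finite batches" by simp
    show "indep_vars (\<lambda>_. count_space batches) ?I ?K" by (rule I_indep)
    show "distr P (count_space batches) (?I i) = uniform_count_measure batches" if "i \<in> ?K" for i
      using that I_unif by auto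
    show "inj_on ?\<tau> ?K"
    proof (rule inj_onI)
      fix i i' assume h: "i \<in> ?K" "i' \<in> ?K" "?\<tau> i = ?\<tau> i'"
      have "(?\<tau> j div m, ?\<tau> j mod m) = (fst j - 1, snd j)" if "j \<in> ?K" for j using that by auto
      then have "(fst i - 1, snd i) = (fst i' - 1, snd i')" using h by metis
      then show "i = i'" using h(1,2) by (auto simp: prod_eq_iff)
    qed
  qed
  define idx where "idx = (\<lambda>k. (k div m + 1, k mod m))"
  define w where "w = (\<lambda>k x. \<omega> (k div m + 1) (k mod m) x)"
  define v where "v = (\<lambda>k x. V (k div m + 1) (k mod m) x)"
  define a where "a = (\<lambda>k. \<alpha> (k div m + 1) (k mod m))"
  define \<phi>' where "\<phi>' = (\<lambda>k. \<phi> (k div m + 1) (k mod m))"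
  define \<psi>' where "\<psi>' = (\<lambda>k. \<psi> (k div m + 1) (k mod m))"
  define dir where "dir = (\<lambda>k x. direction (k mod m = 1) (\<phi>' k) (\<psi>' k) (a (k - 1))
      (w (k - k mod m) x) (w (k - 1) x) (v (k - 1) x) (w k x))"
  define Q where "Q = (\<lambda>k x. drift (\<psi>' k) (a (k - 1)) (w (k - 1) x) (v (k - 1) x) (w k x))"
  have idx: "idx k \<in> ?K" "?\<tau> (idx k) = k" if "k mod m \<noteq> 0" for k
    using that m by (auto simp: idx_def)
  have w0: "w 0 x = \<omega>init" and w_Suc: "w (Suc k) x = R (w k x) (- (a k *\<^sub>R v k x))"
    and v_start: "k mod m = 0 \<Longrightarrow> v k x = gf (w k x)"
    and v_inner: "k mod m \<noteq> 0 \<Longrightarrow> v k x = dir k x (?I (idx k) x)" if "x \<in> space P" for x k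
    using run_flattened(1)[OF run[rule_format, OF that] m]
      run_flattened(2-4)[OF run[rule_format, OF that] m, of k]
    by (simp_all add: w_def v_def a_def \<phi>'_def \<psi>'_def dir_def idx_def)
  have \<phi>\<psi>': "\<phi>' k \<ge> 0 \<and> \<psi>' k \<ge> 0 \<and> \<phi>' k + \<psi>' k \<le> 1" if "k mod m \<noteq> 0" for k
    using \<phi>\<psi> that m by (simp add: \<phi>'_def \<psi>'_def)
  have I_batch: "?I (idx k) x \<in> batches" if "x \<in> space P" "k mod m \<noteq> 0" for x k
    using measurable_space[OF choices_measurable[OF idx(1)[OF that(2)]] that(1)] by simp

  have a_pos: "a k > 0" for k using \<alpha> m by (simp add: a_def)
  have a_block: "a (s * m + t) = \<alpha> (Suc s) t" if "t < m" for s t using that by (simp add: a_def)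
  have a_sq: "summable (\<lambda>k. (a k)\<^sup>2)"
  proof (rule summable_of_blocks)
    show "m > 0" using m by simp
    show "summable (\<lambda>s. \<Sum>t<m. (a (s * m + t))\<^sup>2)" using \<alpha>_sq_sum by (simp add: a_block)
  qed simp
  have a_sum: "\<not> summable a"
  proof
    assume "summable a"
    then have "summable (\<lambda>s. \<Sum>t<m. a (s * m + t))"
      using a_pos by (intro summable_imp_blocks less_imp_le)
    then show False using \<alpha>_sum by (simp add: a_block)
  qed

  (* the point reached at time k is a function of the choices made before, which makes the
     fluctuation of the direction around its mean an innovation *)
  have trace: "(\<forall>j\<le>k. w j x = w j y) \<and> (\<forall>j<k. v j x = v j y)"
    if "x \<in> space P" "y \<in> space P" "\<forall>i\<in>past k. ?I i x = ?I i y" for x y k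
    using that(3)
  proof (induction k)
    case 0
    then show ?case using w0 that by simp
  next
    case (Suc k)
    have IH: "\<And>j. j \<le> k \<Longrightarrow> w j x = w j y" "\<And>j. j < k \<Longrightarrow> v j x = v j y"
      using Suc past_mono[of k "Suc k"] by auto
    have vk: "v k x = v k y"
    proof (cases "k mod m = 0")
      case True
      then show ?thesis using v_start that IH(1)[of k] by simp
    next
      case False
      then have "k > 0" by (cases k) auto
      then have "dir k x = dir k y" using IH(1)[of "k - k mod m"] IH(1)[of "k - 1"] IH(1)[of k] IH(2)[of "k - 1"]
        by (simp add: dir_def)
      moreover have "idx k \<in> past (Suc k)"
        by (rule in_past[OF idx(1)[OF False]]) (simp only: idx(2)[OF False] lessI)
      then have "?I (idx k) x = ?I (idx k) y" using Suc.prems by blast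
      ultimately show ?thesis using v_inner[OF _ False] that by metis
    qed
    moreover have "w (Suc k) x = w (Suc k) y" using w_Suc that vk IH(1)[of k] by simp
    ultimately show ?case using IH by (auto simp: le_Suc_eq less_Suc_eq)
  qed
  have state_eq: "w k x = w k y \<and> dir k x = dir k y \<and> Q k x = Q k y"
    if "x \<in> space P" "y \<in> space P" "\<forall>i\<in>past k. ?I i x = ?I i y" "k mod m \<noteq> 0" for x y k
  proof -
    have "k > 0" using that(4) by (cases k) auto
    then show ?thesis using trace[OF that(1-3)] by (simp add: dir_def Q_def)
  qed
  have w_adapted: "adapted k (w k)" for k
    unfolding adapted_def using trace by blast

  (* at the start of an epoch the direction is the exact gradient, hence free of noise *)
  define \<xi> where "\<xi> = (\<lambda>k x. if k mod m = 0 then 0 else g (w k x) (v k x) (gf (w k x)) - Q k x)"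
  have \<xi>_innovation: "innovation k (\<xi> k)" for k
  proof (cases "k mod m = 0")
    case True
    then show ?thesis by (intro zero_innovation) (simp add: \<xi>_def)
  next
    case False
    let ?h = "\<lambda>x B. g (w k x) (dir k x B) (gf (w k x)) - Q k x"
    show ?thesis
    proof (rule centred_choice_innovation[OF idx[OF False], where h = ?h])
      show "adapted k (\<lambda>x. ?h x B)" for B
        unfolding adapted_def using state_eq[OF _ _ _ False] by metis
      show "(\<Sum>B\<in>batches. ?h x B) = 0" for x
        unfolding dir_def Q_def sum_subtractf sum_direction_inner_gradient by simp
      show "\<xi> k x = ?h x (?I (idx k) x)" if "x \<in> space P" for x
        using False v_inner[OF that False] by (simp add: \<xi>_def)
    qed
  qed

  obtain L where L: "L \<ge> 0" "\<And>p. p \<in> \<Omega> \<Longrightarrow> tnorm g p (gf p) \<le> L"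
    "\<And>p v. p \<in> \<Omega> \<Longrightarrow> R p v \<in> \<Omega> \<Longrightarrow> f (R p v) \<le> f p + g p (gf p) v + L * (tnorm g p v)\<^sup>2"
    "\<And>p v. p \<in> \<Omega> \<Longrightarrow> R p v \<in> \<Omega> \<Longrightarrow>
       \<bar>(tnorm g (R p v) (gf (R p v)))\<^sup>2 - (tnorm g p (gf p))\<^sup>2\<bar> \<le> L * tnorm g p v"
    by (rule descent_on_compact[OF manifold retraction f2 \<Omega>(1)]) blast
  have "\<exists>c. c \<ge> 0 \<and> (\<forall>p\<in>\<Omega>. tnorm g p (grad A g (fs i) p) \<le> c)" if "i \<in> {1..n}" for i
    by (rule descent_on_compact[OF manifold retraction fs2[OF that] \<Omega>(1)]) blast
  then obtain cs where cs: "\<And>i. i \<in> {1..n} \<Longrightarrow> cs i \<ge> 0 \<and> (\<forall>p\<in>\<Omega>. tnorm g p (grad A g (fs i) p) \<le> cs i)"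
    by metis
  define C where "C = L + sum cs {1..n}"
  have sum_cs: "sum cs {1..n} \<ge> 0" using cs by (intro sum_nonneg) auto
  have C0: "C \<ge> 0" using L(1) sum_cs by (simp add: C_def)
  have C: "tnorm g p (grad A g (fs i) p) \<le> C" if "p \<in> \<Omega>" "i \<in> {1..n}" for p i
  proof -
    have "cs i \<le> sum cs {1..n}" using cs that(2) by (intro member_le_sum) auto
    then show ?thesis using cs[OF that(2)] that(1) L(1) by (auto simp: C_def intro: order.trans)
  qed
  have Cf: "tnorm g p (gf p) \<le> C" if "p \<in> \<Omega>" for p
    using L(2)[OF that] sum_cs by (simp add: C_def)
  define M where "M = (3 * real m + 1) * C"
  have M0: "M \<ge> 0" using C0 by (simp add: M_def)
  have confined: "AE x in P. x \<in> space P \<and> (\<forall>k. w k x \<in> \<Omega>)"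
    using iterates_in_\<Omega> AE_space by eventually_elim (use m in \<open>simp add: w_def\<close>)
  have v_bound: "tnorm g (w k x) (v k x) \<le> M" if x: "x \<in> space P" "\<forall>k. w k x \<in> \<Omega>" for x k
  proof -
    have "tnorm g (w k x) (v k x) \<le> (3 * real (k mod m) + 1) * C"
      by (rule directions_bounded[where w = "\<lambda>k. w k x" and v = "\<lambda>k. v k x" and a = a and m = m
            and \<phi> = \<phi>' and \<psi> = \<psi>' and J = "\<lambda>k. ?I (idx k) x" and \<Omega> = \<Omega> and C = C])
        (use w_Suc v_start v_inner I_batch \<phi>\<psi>' R_diffeo C Cf x in \<open>simp_all add: dir_def\<close>)
    also have "\<dots> \<le> M" unfolding M_def using C0 m by (intro mult_right_mono) auto
    finally show ?thesis .
  qed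
  define c where "c = M * C + 2 * C\<^sup>2"
  have \<xi>_bound: "\<bar>\<xi> k x\<bar> \<le> c" if x: "x \<in> space P" "\<forall>k. w k x \<in> \<Omega>" for x k
  proof (cases "k mod m = 0")
    case False
    have N: "(tnorm g (w k x) (gf (w k x)))\<^sup>2 \<le> C\<^sup>2"
      using Cf x(2) tnorm_nonneg[OF manifold] by (intro power_mono) auto
    have "\<bar>g (w k x) (v k x) (gf (w k x))\<bar> \<le> tnorm g (w k x) (v k x) * tnorm g (w k x) (gf (w k x))"
      by (rule metric_Cauchy_Schwarz[OF manifold])
    also have "\<dots> \<le> M * C"
      using v_bound[OF x] Cf x(2) M0 tnorm_nonneg[OF manifold] by (intro mult_mono) auto
    finally have "\<bar>g (w k x) (v k x) (gf (w k x))\<bar> \<le> M * C" .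
    moreover have "\<bar>Q k x\<bar> \<le> 2 * C\<^sup>2"
      unfolding Q_def using drift_bounds(2) \<phi>\<psi>'[OF False] N by (meson order.trans mult_left_mono zero_le_numeral)
    ultimately show ?thesis using False by (simp add: \<xi>_def c_def)
  qed (use M0 C0 in \<open>simp add: \<xi>_def c_def\<close>)

  have noise: "AE x in P. summable (\<lambda>k. a k * \<xi> k x)"
  proof (rule innovation_series_summable)
    show inn: "innovation k (\<lambda>x. a k * \<xi> k x)" for k
      by (rule innovation_gate[OF \<xi>_innovation adapted_const])
    show "expectation (\<lambda>x. (a k * \<xi> k x)\<^sup>2) \<le> (a k)\<^sup>2 * c\<^sup>2" for k
    proof (rule integral_le_const)
      have "adapted (Suc k) (\<lambda>x. a k * \<xi> k x)"
        using inn[of k] unfolding innovation_def by blast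
      from adapted_integrable_power2[OF this] show "integrable P (\<lambda>x. (a k * \<xi> k x)\<^sup>2)" .
      show "AE x in P. (a k * \<xi> k x)\<^sup>2 \<le> (a k)\<^sup>2 * c\<^sup>2"
        using confined
      proof eventually_elim
        case (elim x)
        have "\<bar>\<xi> k x\<bar>\<^sup>2 \<le> c\<^sup>2" using \<xi>_bound elim by (intro power_mono) auto
        then show ?case by (simp add: power_mult_distrib mult_left_mono)
      qed
    qed
    show "summable (\<lambda>k. (a k)\<^sup>2 * c\<^sup>2)" by (intro summable_mult2 a_sq)
  qed

  have main: "AE x in P. convergent (\<lambda>k. f (w k x)) \<and> (\<lambda>k. (tnorm g (w k x) (gf (w k x)))\<^sup>2) \<longlonglongrightarrow> 0"
    using confined noise
  proof eventually_elim
    case (elim x)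
    then have x: "x \<in> space P" "\<forall>k. w k x \<in> \<Omega>" by auto
    let ?N = "\<lambda>k. (tnorm g (w k x) (gf (w k x)))\<^sup>2"
    let ?e = "\<lambda>k. L * M\<^sup>2 * (a k)\<^sup>2 - a k * \<xi> k x"
    have step: "tnorm g (w k x) (- (a k *\<^sub>R v k x)) \<le> a k * M" for k
      using v_bound[OF x, of k] a_pos[of k] tnorm_scaleR[OF manifold, of "w k x" "- a k" "v k x"]
      by (simp add: mult_left_mono)
    have stays: "R (w k x) (- (a k *\<^sub>R v k x)) \<in> \<Omega>" for k using w_Suc[OF x(1), of k] x(2) by metis
    have desc: "f (w (Suc k) x) \<le> f (w k x) - (1 - \<mu>) * (a k * ?N k) + ?e k" for k
    proof -
      have "(1 - \<mu>) * ?N k + \<xi> k x \<le> g (w k x) (v k x) (gf (w k x))"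
      proof (cases "k mod m = 0")
        case True
        have "(1 - \<mu>) * ?N k \<le> 1 * ?N k" using \<mu> by (intro mult_right_mono) auto
        then show ?thesis using v_start[OF x(1) True] True by (simp add: \<xi>_def tnorm_sq[OF manifold])
      next
        case False
        then show ?thesis
          using drift_bounds(1)[of "\<psi>' k" "w k x"] \<phi>\<psi>'[OF False] by (simp add: \<xi>_def Q_def)
      qed
      then have "a k * ((1 - \<mu>) * ?N k + \<xi> k x) \<le> a k * g (w k x) (v k x) (gf (w k x))"
        using a_pos[of k] by (intro mult_left_mono) auto
      moreover have "g (w k x) (gf (w k x)) (- (a k *\<^sub>R v k x)) = - (a k * g (w k x) (v k x) (gf (w k x)))"
        using manifold bilinear_rmul[OF bilinear_metric, of "w k x" "gf (w k x)" "- a k" "v k x"]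
        unfolding riemannian_manifold_def by simp
      moreover have "L * (tnorm g (w k x) (- (a k *\<^sub>R v k x)))\<^sup>2 \<le> L * (a k * M)\<^sup>2"
        using step L(1) tnorm_nonneg[OF manifold] by (intro mult_left_mono power_mono) auto
      then have "L * (tnorm g (w k x) (- (a k *\<^sub>R v k x)))\<^sup>2 \<le> L * M\<^sup>2 * (a k)\<^sup>2"
        by (simp only: power_mult_distrib mult.assoc mult.commute[of "(a k)\<^sup>2"])
      ultimately show ?thesis
        using L(3)[OF x(2)[rule_format, of k] stays] w_Suc[OF x(1), of k]
        by (simp add: algebra_simps)
    qed
    have lip: "\<bar>?N (Suc k) - ?N k\<bar> \<le> (L * M) * a k" for k
    proof -
      have "\<bar>?N (Suc k) - ?N k\<bar> \<le> L * tnorm g (w k x) (- (a k *\<^sub>R v k x))"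
        using L(4)[OF x(2)[rule_format, of k] stays] w_Suc[OF x(1), of k] by simp
      also have "\<dots> \<le> L * (a k * M)" using step L(1) by (intro mult_left_mono)
      finally show ?thesis by (simp add: mult_ac)
    qed
    have e: "summable ?e" using elim by (intro summable_diff summable_mult a_sq) auto
    have \<kappa>: "1 - \<mu> > 0" using \<mu> by simp
    have nn: "f (w k x) \<ge> 0" "?N k \<ge> 0" "a k \<ge> 0" for k
      using f_nonneg a_pos[of k] by auto
    show ?case
      using descent_sequence_converges[of "\<lambda>k. f (w k x)" ?N a ?e "1 - \<mu>" "L * M",
          OF nn a_sum a_sq e \<kappa> desc lip] by blast
  qed
  have "AE x in P. (\<lambda>k. let p = w k x in tnorm g p (gf p)) \<longlonglongrightarrow> 0"
    using main
  proof eventually_elim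
    case (elim x)
    then have "(\<lambda>k. sqrt ((tnorm g (w k x) (gf (w k x)))\<^sup>2)) \<longlonglongrightarrow> sqrt 0"
      by (intro tendsto_real_sqrt) simp
    then show ?case by (simp add: tnorm_nonneg[OF manifold] Let_def)
  qed
  moreover have "\<exists>X\<in>borel_measurable P. AE x in P. (\<lambda>k. f (w k x)) \<longlonglongrightarrow> (X x :: real)"
  proof (rule bexI)
    show "(\<lambda>x. lim (\<lambda>k. f (w k x))) \<in> borel_measurable P"
      by (intro borel_measurable_lim_metric adapted_bounded_measurable(1)[OF adapted_comp[OF w_adapted]])
    show "AE x in P. (\<lambda>k. f (w k x)) \<longlonglongrightarrow> lim (\<lambda>k. f (w k x))"
      using main by eventually_elim (simp add: convergent_LIMSEQ_iff)
  qed
  ultimately show ?thesis by (simp add: w_def)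
qed

end
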